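(* Let $K:\mathbb{Z}^2\times\mathbb{Z}^2\to\mathbb{C}$ be a positive definite map such that $$K((j,k),(j',k'))=K((j+1,k),(j'+1,k'))\quad\text{for all } j,j',k,k'\in\mathbb{Z},$$ and $$K((j,k),(j',k'))=K((j,2^{-j}+k),(j',2^{-j'}+k'))\quad\text{for all } j,j'\le 0,\ k,k'\in\mathbb{Z}.$$ Then there exist a Hilbert space $H$, unitary operators $U,T$ on $H$ with $UTU^{-1}=T^2$ (i.e. a unitary representation of the Baumslag–Solitar group $BS(1,2)=\langle u,t\mid utu^{-1}=t^2\rangle$), and a vector $\psi\in H$ such that $$\langle U^jT^k\psi,U^{j'}T^{k'}\psi\rangle=K((j,k),(j',k'))\quad\text{for all } j,j',k,k'\in\mathbb{Z},$$ and $\overline{\operatorname{span}}\{U^jT^k\psi\mid j,k\in\mathbb{Z}\}=H$.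
   Context: A map $K:X\times X\to\mathbb{C}$ is positive definite if for every finite family $x_1,\dots,x_n\in X$ and $\xi_1,\dots,\xi_n\in\mathbb{C}$ one has $\sum_{i,j}K(x_i,x_j)\xi_i\overline{\xi_j}\ge 0$. *)

theory Defs
  imports Complex_Main "HOL-Library.Complex_Order"
begin

definition pos_def_kernel :: "('x \<Rightarrow> 'x \<Rightarrow> complex) \<Rightarrow> bool" where
  "pos_def_kernel K \<longleftrightarrow>
     (\<forall>(n::nat) (x::nat \<Rightarrow> 'x) (\<xi>::nat \<Rightarrow> complex).
        (\<Sum>i<n. \<Sum>j<n. K (x i) (x j) * \<xi> i * cnj (\<xi> j)) \<ge> 0)"

text \<open>A complex Hilbert space, given concretely by a carrier set inside some ambient
  type together with its operations (inner product linear in the first argument).\<close>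
record 'a hspace =
  hcarrier :: "'a set"
  hadd :: "'a \<Rightarrow> 'a \<Rightarrow> 'a"
  hzero :: "'a"
  hscale :: "complex \<Rightarrow> 'a \<Rightarrow> 'a"
  hinner :: "'a \<Rightarrow> 'a \<Rightarrow> complex"

definition hsub :: "'a hspace \<Rightarrow> 'a \<Rightarrow> 'a \<Rightarrow> 'a" where
  "hsub H x y = hadd H x (hscale H (-1) y)"

definition hnorm :: "'a hspace \<Rightarrow> 'a \<Rightarrow> real" where
  "hnorm H x = sqrt (Re (hinner H x x))"

definition complex_hilbert_space :: "'a hspace \<Rightarrow> bool" where
  "complex_hilbert_space H \<longleftrightarrow>
     (let C = hcarrier H; p = hadd H; z = hzero H; s = hscale H; ip = hinner H in
     \<comment> \<open>complex vector space\<close>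
     z \<in> C \<and>
     (\<forall>x\<in>C. \<forall>y\<in>C. p x y \<in> C) \<and>
     (\<forall>a. \<forall>x\<in>C. s a x \<in> C) \<and>
     (\<forall>x\<in>C. \<forall>y\<in>C. \<forall>w\<in>C. p (p x y) w = p x (p y w)) \<and>
     (\<forall>x\<in>C. \<forall>y\<in>C. p x y = p y x) \<and>
     (\<forall>x\<in>C. p x z = x) \<and>
     (\<forall>x\<in>C. p x (s (-1) x) = z) \<and>
     (\<forall>a b. \<forall>x\<in>C. s a (s b x) = s (a * b) x) \<and>
     (\<forall>x\<in>C. s 1 x = x) \<and>
     (\<forall>a. \<forall>x\<in>C. \<forall>y\<in>C. s a (p x y) = p (s a x) (s a y)) \<and>
     (\<forall>a b. \<forall>x\<in>C. s (a + b) x = p (s a x) (s b x)) \<and>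
     \<comment> \<open>inner product\<close>
     (\<forall>x\<in>C. \<forall>y\<in>C. \<forall>w\<in>C. ip (p x y) w = ip x w + ip y w) \<and>
     (\<forall>a. \<forall>x\<in>C. \<forall>y\<in>C. ip (s a x) y = a * ip x y) \<and>
     (\<forall>x\<in>C. \<forall>y\<in>C. ip y x = cnj (ip x y)) \<and>
     (\<forall>x\<in>C. ip x x \<ge> 0) \<and>
     (\<forall>x\<in>C. ip x x = 0 \<longrightarrow> x = z) \<and>
     \<comment> \<open>completeness w.r.t. the induced norm\<close>
     (\<forall>f::nat \<Rightarrow> 'a. (\<forall>n. f n \<in> C) \<longrightarrow>
        (\<forall>e>0. \<exists>N. \<forall>m\<ge>N. \<forall>n\<ge>N. hnorm H (hsub H (f m) (f n)) < e) \<longrightarrow>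
        (\<exists>l\<in>C. (\<lambda>n. hnorm H (hsub H (f n) l)) \<longlonglongrightarrow> 0)))"

definition unitary_op :: "'a hspace \<Rightarrow> ('a \<Rightarrow> 'a) \<Rightarrow> bool" where
  "unitary_op H U \<longleftrightarrow>
     bij_betw U (hcarrier H) (hcarrier H) \<and>
     (\<forall>x\<in>hcarrier H. \<forall>y\<in>hcarrier H. U (hadd H x y) = hadd H (U x) (U y)) \<and>
     (\<forall>a. \<forall>x\<in>hcarrier H. U (hscale H a x) = hscale H a (U x)) \<and>
     (\<forall>x\<in>hcarrier H. \<forall>y\<in>hcarrier H. hinner H (U x) (U y) = hinner H x y)"

definition op_ipow :: "'a hspace \<Rightarrow> ('a \<Rightarrow> 'a) \<Rightarrow> int \<Rightarrow> 'a \<Rightarrow> 'a" where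
  "op_ipow H U j = (if j \<ge> 0 then U ^^ nat j else (inv_into (hcarrier H) U) ^^ nat (- j))"

definition hspan :: "'a hspace \<Rightarrow> 'a set \<Rightarrow> 'a set" where
  "hspan H S = {foldr (\<lambda>(a, v) acc. hadd H (hscale H a v) acc) cs (hzero H) | cs.
                  set (map snd cs) \<subseteq> S}"

definition dense_span :: "'a hspace \<Rightarrow> 'a set \<Rightarrow> bool" where
  "dense_span H S \<longleftrightarrow>
     (\<forall>x\<in>hcarrier H. \<forall>e>0. \<exists>y\<in>hspan H S. hnorm H (hsub H x y) < e)"

end

theory Submission
  imports Defs "HOL-Analysis.Analysis"
begin

text \<open>
  Let \<open>e j k\<close> be Gram vectors of the kernel, with closed span \<open>H\<close>, and let \<open>H n\<close> be the closed
  span of those with \<open>j \<le> n\<close>. The first invariance gives the unitary \<open>U\<close>, which maps \<open>H n\<close> onto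
  \<open>H (n + 1)\<close>; the second gives a unitary \<open>T\<close> on \<open>H 0\<close> which satisfies the relation there. Nothing is
  prescribed for \<open>j > 0\<close>, so \<open>T\<close> is extended from \<open>H n\<close> to \<open>H (n + 1)\<close> by hand: \<open>V = U T U\<^sup>-\<^sup>1\<close> is
  unitary on \<open>H (n + 1)\<close> and equals \<open>T\<^sup>2\<close> on \<open>H n\<close>, so it suffices to take any unitary square root
  of \<open>V\<close> on the orthogonal complement of \<open>H n\<close>.

  A unitary \<open>V\<close> has the square root \<open>W\<close> given by \<open>W (P x) = (1 + V) x\<close> with \<open>P\<close> a self-adjoint root of
  \<open>(1 + V)\<^sup>* (1 + V) = 2 + V + V\<^sup>-\<^sup>1\<close>, and by \<open>W = \<i>\<close> on the kernel of \<open>1 + V\<close>. Indeed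
  \<open>W\<^sup>2 P\<^sup>2 = (1 + V)\<^sup>2 = V P\<^sup>2\<close>.
\<close>

section \<open>Orthogonal projections and extension of isometries\<close>

text \<open>For \<open>j > 0\<close> the number \<open>2^(-j)\<close> is not an integer:
  \<open>T\<close> would have to send \<open>e j k\<close> to a vector
  \<open>e j (k + 2^(-j))\<close>, and the family contains no such vector. Adjoining new vectors
  could destroy the density of the orbit, so the missing values of \<open>T\<close> have to be found
  inside \<open>H\<close>. Whatever is chosen there leaves the prescribed inner products intact,
  because the vectors \<open>U^j T^k (e 0 0)\<close> involve \<open>T\<close> only on the
  \<open>e 0 k\<close>. The relation \<open>U T = T^2 U\<close> on level \<open>n\<close> is the
  same as \<open>T^2 = U T U^(-1)\<close> on level \<open>n + 1\<close>; this turns the extension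
  step into a square root problem.

  The formula for the root is a polar decomposition. For a scalar \<open>V = exp (i t)\<close> with
  \<open>|t| < pi\<close>, the quotient \<open>(1 + V) / |1 + V|\<close> is
  \<open>exp (i t / 2)\<close>, the principal root. It is undefined only at \<open>V = -1\<close>,
  where the imaginary unit is one of the two roots. The denominator is the square root of a positive
  operator, and the binomial series of \<open>sqrt (1 - A)\<close> supplies it.\<close>

definition orth_compl :: "'a::real_inner set \<Rightarrow> 'a set" where
  "orth_compl E = {y. \<forall>x\<in>E. y \<bullet> x = 0}"

lemma orth_compl_iff: "y \<in> orth_compl E \<longleftrightarrow> (\<forall>x\<in>E. y \<bullet> x = 0)"
  by (simp add: orth_compl_def)

lemma subspace_orth_compl: "subspace (orth_compl E)"
  by (auto simp: subspace_def orth_compl_def inner_add_left)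

lemma closed_orth_compl: "closed (orth_compl E)"
proof -
  have "orth_compl E = (\<Inter>x\<in>E. {y. y \<bullet> x = 0})"
    by (auto simp: orth_compl_def)
  then show ?thesis
    by (auto intro!: closed_INT closed_Collect_eq continuous_intros)
qed

lemma parallelogram_midpoint:
  fixes x :: "'a::real_inner"
  shows "(norm (y - z))\<^sup>2 = 2 * (norm (x - y))\<^sup>2 + 2 * (norm (x - z))\<^sup>2
    - 4 * (norm (x - (1/2) *\<^sub>R (y + z)))\<^sup>2"
  by (simp add: power2_norm_eq_inner inner_diff_left inner_diff_right inner_add_left
      inner_add_right inner_commute algebra_simps)

text \<open>A minimizing sequence is Cauchy: midpoints of its terms stay in \<open>S\<close>, hence
  at distance at least \<open>d\<close> from \<open>x\<close>, and the parallelogram law bounds the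
  distance of two terms by the excess of their squared distances over \<open>d^2\<close>.\<close>

lemma closest_point_in_subspace:
  fixes S :: "'a::{real_inner,banach} set"
  assumes S: "subspace S" "closed S"
  shows "\<exists>y\<in>S. norm (x - y) = infdist x S"
proof -
  have ne: "S \<noteq> {}" using S(1) subspace_0 by blast
  define d where "d = infdist x S"
  have d0: "d \<ge> 0" by (simp add: d_def infdist_nonneg)
  have low: "d \<le> norm (x - y)" if "y \<in> S" for y
    unfolding d_def using infdist_le[OF that, of x] by (simp add: dist_norm)
  have "\<exists>y\<in>S. norm (x - y) < d + 1 / real (Suc n)" for n
  proof -
    have "infdist x S < d + 1 / real (Suc n)" by (simp add: d_def)
    moreover have "bdd_below (dist x ` S)" by (rule bdd_belowI[of _ 0]) auto
    ultimately show ?thesis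
      unfolding infdist_notempty[OF ne] using ne
      by (subst (asm) cINF_less_iff) (auto simp: dist_norm)
  qed
  then obtain y where y: "\<And>n. y n \<in> S" "\<And>n. norm (x - y n) < d + 1 / real (Suc n)"
    by metis
  define b where "b n = (d + 1 / real (Suc n))\<^sup>2 - d\<^sup>2" for n :: nat
  have "(\<lambda>n. (d + 1 / real (Suc n))\<^sup>2 - d\<^sup>2) \<longlonglongrightarrow> (d + 0)\<^sup>2 - d\<^sup>2"
    by (intro tendsto_intros lim_1_over_n[THEN LIMSEQ_Suc])
  then have b: "b \<longlonglongrightarrow> 0" by (simp add: b_def[abs_def])
  have mid: "(norm (y m - y n))\<^sup>2 \<le> 2 * b m + 2 * b n" for m n
  proof -
    have "(1/2) *\<^sub>R (y m + y n) \<in> S"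
      using S(1) y(1) by (intro subspace_scale subspace_add) auto
    then have "d\<^sup>2 \<le> (norm (x - (1/2) *\<^sub>R (y m + y n)))\<^sup>2"
      using low d0 by (intro power_mono) auto
    moreover have "(norm (x - y k))\<^sup>2 \<le> (d + 1 / real (Suc k))\<^sup>2" for k
      using y(2)[of k] by (intro power_mono) auto
    ultimately show ?thesis
      unfolding parallelogram_midpoint[of "y m" "y n" x] b_def
      using \<open>\<And>k. (norm (x - y k))\<^sup>2 \<le> (d + 1 / real (Suc k))\<^sup>2\<close>[of m]
        \<open>\<And>k. (norm (x - y k))\<^sup>2 \<le> (d + 1 / real (Suc k))\<^sup>2\<close>[of n] by argo
  qed
  have "Cauchy y"
  proof (rule metric_CauchyI)
    fix e :: real assume "e > 0"
    then have "e\<^sup>2 / 4 > 0" by simp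
    from order_tendstoD(2)[OF b this] obtain N where N: "\<And>n. n \<ge> N \<Longrightarrow> b n < e\<^sup>2 / 4"
      by (auto simp: eventually_sequentially)
    show "\<exists>M. \<forall>m\<ge>M. \<forall>n\<ge>M. dist (y m) (y n) < e"
    proof (intro exI allI impI)
      fix m n assume "m \<ge> N" "n \<ge> N"
      then have "(norm (y m - y n))\<^sup>2 < e\<^sup>2"
        using mid[of m n] N[of m] N[of n] by linarith
      then show "dist (y m) (y n) < e"
        using \<open>e > 0\<close> by (simp add: dist_norm power2_less_imp_less)
    qed
  qed
  then obtain l where l: "y \<longlonglongrightarrow> l" using Cauchy_convergent convergent_def by blast
  have lS: "l \<in> S" using closed_sequentially[OF S(2) _ l] y(1) by blast
  have "norm (x - l) \<le> d"
  proof (rule LIMSEQ_le)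
    show "(\<lambda>n. norm (x - y n)) \<longlonglongrightarrow> norm (x - l)" by (intro tendsto_intros l)
    show "(\<lambda>n. d + 1 / real (Suc n)) \<longlonglongrightarrow> d"
      using tendsto_add[OF tendsto_const lim_1_over_n[THEN LIMSEQ_Suc], of d] by simp
  qed (use y(2) less_imp_le in blast)
  with low[OF lS] lS show ?thesis by (auto simp: d_def intro!: bexI[of _ l])
qed

lemma orth_decomp:
  fixes S :: "'a::{real_inner,banach} set"
  assumes S: "subspace S" "closed S"
  shows "\<exists>y\<in>S. x - y \<in> orth_compl S"
proof -
  obtain y where y: "y \<in> S" "norm (x - y) = infdist x S"
    using closest_point_in_subspace[OF S] by blast
  have "(x - y) \<bullet> z = 0" if z: "z \<in> S" for z
  proof (cases "z = 0")
    case False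
    \<comment> \<open>\<open>t *\<^sub>R z\<close> is the projection of the residual
      \<open>x - y\<close> to the line of \<open>z\<close>. Moving \<open>y\<close> by it lowers the
      squared distance by \<open>((x - y) \<bullet> z)^2 / (z \<bullet> z)\<close>, which minimality
      forces to be zero.\<close>
    define t where "t = ((x - y) \<bullet> z) / (z \<bullet> z)"
    have "y + t *\<^sub>R z \<in> S" using S(1) y(1) z by (intro subspace_add subspace_scale)
    from infdist_le[OF this, of x] have "norm (x - y) \<le> norm (x - (y + t *\<^sub>R z))"
      by (simp add: y(2) dist_norm)
    then have "(norm (x - y))\<^sup>2 \<le> (norm ((x - y) - t *\<^sub>R z))\<^sup>2"
      by (intro power_mono) (auto simp: algebra_simps)
    also have "\<dots> = (norm (x - y))\<^sup>2 - ((x - y) \<bullet> z)\<^sup>2 / (z \<bullet> z)"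
      using False unfolding power2_norm_eq_inner inner_diff_left[of "x - y" "t *\<^sub>R z"]
        inner_diff_right[of _ "x - y" "t *\<^sub>R z"]
      by (simp add: t_def inner_commute[of z "x - y"] power2_eq_square)
    finally have "((x - y) \<bullet> z)\<^sup>2 / (z \<bullet> z) \<le> 0" by simp
    then show ?thesis using False
      by (simp add: divide_le_0_iff) (metis inner_ge_zero inner_eq_zero_iff order_antisym)
  qed simp
  with y(1) show ?thesis by (auto simp: orth_compl_iff)
qed

definition orth_proj :: "'a::{real_inner,banach} set \<Rightarrow> 'a \<Rightarrow> 'a" where
  "orth_proj S x = (SOME y. y \<in> S \<and> x - y \<in> orth_compl S)"

context
  fixes S :: "'a::{real_inner,banach} set"
  assumes S: "subspace S" "closed S"
begin

lemma orth_proj_in: "orth_proj S x \<in> S" and orth_proj_orth: "x - orth_proj S x \<in> orth_compl S"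
  using someI_ex[of "\<lambda>y. y \<in> S \<and> x - y \<in> orth_compl S"] orth_decomp[OF S, of x]
  unfolding orth_proj_def by blast+

lemma orth_proj_unique:
  assumes "y \<in> S" "x - y \<in> orth_compl S"
  shows "orth_proj S x = y"
proof -
  have "orth_proj S x - y \<in> S" using S(1) orth_proj_in assms(1) by (intro subspace_diff)
  moreover have "(x - y) - (x - orth_proj S x) \<in> orth_compl S"
    by (intro subspace_diff[OF subspace_orth_compl] assms(2) orth_proj_orth)
  ultimately have "(orth_proj S x - y) \<bullet> (orth_proj S x - y) = 0"
    by (simp add: orth_compl_iff)
  then show ?thesis by simp
qed

lemma orth_proj_id: "x \<in> S \<Longrightarrow> orth_proj S x = x"
  by (rule orth_proj_unique) (auto simp: orth_compl_iff)

lemma norm_orth_proj_le: "norm (orth_proj S x) \<le> norm x"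
proof -
  have "(norm x)\<^sup>2 = (norm (orth_proj S x))\<^sup>2 + (norm (x - orth_proj S x))\<^sup>2"
    using norm_add_Pythagorean[of "orth_proj S x" "x - orth_proj S x"] orth_proj_in orth_proj_orth
    by (auto simp: orthogonal_def orth_compl_iff inner_commute)
  then have "(norm (orth_proj S x))\<^sup>2 \<le> (norm x)\<^sup>2" by simp
  then show ?thesis by (rule power2_le_imp_le) simp
qed

lemma bounded_linear_orth_proj: "bounded_linear (orth_proj S)"
proof (rule bounded_linear_intro[of _ 1])
  show "orth_proj S (x + y) = orth_proj S x + orth_proj S y" for x y
  proof (rule orth_proj_unique)
    have "(x - orth_proj S x) + (y - orth_proj S y) \<in> orth_compl S"
      by (intro subspace_add subspace_orth_compl orth_proj_orth)
    then show "x + y - (orth_proj S x + orth_proj S y) \<in> orth_compl S" by (simp add: algebra_simps)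
  qed (intro subspace_add S orth_proj_in)
  show "orth_proj S (c *\<^sub>R x) = c *\<^sub>R orth_proj S x" for c x
  proof (rule orth_proj_unique)
    have "c *\<^sub>R (x - orth_proj S x) \<in> orth_compl S"
      by (intro subspace_scale subspace_orth_compl orth_proj_orth)
    then show "c *\<^sub>R x - c *\<^sub>R orth_proj S x \<in> orth_compl S" by (simp add: algebra_simps)
  qed (intro subspace_scale S orth_proj_in)
qed (simp add: norm_orth_proj_le)

text \<open>Serves to carry a property from generators to a closed space: the vectors having it form
  \<open>E\<close>. The residual of any \<open>x\<close> from its projection to \<open>E\<close>
  lies in \<open>S\<close> and is orthogonal to \<open>E\<close>.\<close>

lemma subset_closed_subspace_total:
  assumes E: "subspace E" "closed E" "E \<subseteq> S"
    and tot: "\<And>y. y \<in> S \<Longrightarrow> y \<in> orth_compl E \<Longrightarrow> y = 0"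
  shows "E = S"
proof
  show "S \<subseteq> E"
  proof
    fix x assume x: "x \<in> S"
    obtain y where y: "y \<in> E" "x - y \<in> orth_compl E" using orth_decomp[OF E(1,2)] by blast
    have "x - y \<in> S" using x y(1) E(3) S(1) by (intro subspace_diff) auto
    from tot[OF this y(2)] y(1) show "x \<in> E" by simp
  qed
qed (rule E(3))

end

lemma orth_compl_closure_span: "orth_compl (closure (span A)) = orth_compl A"
proof
  show "orth_compl (closure (span A)) \<subseteq> orth_compl A"
    using span_superset closure_subset by (fastforce simp: orth_compl_iff)
  show "orth_compl A \<subseteq> orth_compl (closure (span A))"
  proof
    fix y assume y: "y \<in> orth_compl A"
    have "A \<subseteq> orth_compl {y}" using y by (auto simp: orth_compl_iff inner_commute)
    then have "span A \<subseteq> orth_compl {y}" by (intro span_minimal subspace_orth_compl)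
    then have "closure (span A) \<subseteq> orth_compl {y}" by (intro closure_minimal closed_orth_compl)
    then show "y \<in> orth_compl (closure (span A))" by (auto simp: orth_compl_iff inner_commute)
  qed
qed

lemma subspace_closure:
  fixes A :: "'a::real_normed_vector set"
  assumes "subspace A" shows "subspace (closure A)"
proof (rule subspaceI)
  show "0 \<in> closure A" using assms closure_subset subspace_0 by blast
next
  fix x y assume "x \<in> closure A" "y \<in> closure A"
  then obtain f g where "\<And>n. f n \<in> A" "f \<longlonglongrightarrow> x" "\<And>n. g n \<in> A" "g \<longlonglongrightarrow> y"
    unfolding closure_sequential by metis
  then have "\<forall>n. f n + g n \<in> A" "(\<lambda>n. f n + g n) \<longlonglongrightarrow> x + y"
    by (auto intro: tendsto_add subspace_add[OF assms])
  then show "x + y \<in> closure A" unfolding closure_sequential by (intro exI conjI)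
next
  fix c x assume "x \<in> closure A"
  then obtain f where "\<And>n. f n \<in> A" "f \<longlonglongrightarrow> x" unfolding closure_sequential by metis
  then have "\<forall>n. c *\<^sub>R f n \<in> A" "(\<lambda>n. c *\<^sub>R f n) \<longlonglongrightarrow> c *\<^sub>R x"
    by (auto intro: tendsto_scaleR subspace_scale[OF assms])
  then show "c *\<^sub>R x \<in> closure A" unfolding closure_sequential by (intro exI conjI)
qed

lemma bounded_linear_eq_on_total:
  fixes f g :: "'a::{real_inner,banach} \<Rightarrow> 'b::real_normed_vector"
  assumes S: "subspace S" "closed S" and "A \<subseteq> S"
    and tot: "\<And>y. y \<in> S \<Longrightarrow> y \<in> orth_compl A \<Longrightarrow> y = 0"
    and f: "bounded_linear f" and g: "bounded_linear g"
    and eq: "\<And>x. x \<in> A \<Longrightarrow> f x = g x" and x: "x \<in> S"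
  shows "f x = g x"
proof -
  interpret f: bounded_linear f by fact
  interpret g: bounded_linear g by fact
  let ?E = "S \<inter> {x. f x = g x}"
  have "subspace ?E"
    using S(1) by (auto simp: subspace_def f.zero g.zero f.add g.add f.scaleR g.scaleR)
  moreover have "closed ?E"
    by (intro closed_Int S closed_Collect_eq linear_continuous_on f g)
  ultimately have "?E = S"
  proof (intro subset_closed_subspace_total[OF S])
    show "y = 0" if "y \<in> S" "y \<in> orth_compl ?E" for y
      using that assms(3) eq by (intro tot) (auto simp: orth_compl_iff)
  qed auto
  with x show ?thesis by blast
qed

lemma inner_polarization: "(x::'a::real_inner) \<bullet> y = ((norm (x + y))\<^sup>2 - (norm x)\<^sup>2 - (norm y)\<^sup>2) / 2"
  by (simp add: power2_norm_eq_inner inner_add_left inner_add_right inner_commute)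

text \<open>Equal Gram matrices make the assignment of \<open>w i\<close> to \<open>v i\<close>
  respect every linear relation, since a combination vanishes iff its norm does. The isometry
  obtained on the span is uniformly continuous, so it extends to the closure, which is
  \<open>S\<close> by totality.\<close>

lemma isometry_extension:
  fixes v :: "'i \<Rightarrow> 'a::{real_inner,banach}" and w :: "'i \<Rightarrow> 'b::{real_inner,banach}"
  assumes S: "subspace S" "closed S" and vS: "\<And>i. i \<in> I \<Longrightarrow> v i \<in> S"
    and tot: "\<And>y. y \<in> S \<Longrightarrow> (\<And>i. i \<in> I \<Longrightarrow> y \<bullet> v i = 0) \<Longrightarrow> y = 0"
    and gram: "\<And>i j. i \<in> I \<Longrightarrow> j \<in> I \<Longrightarrow> v i \<bullet> v j = w i \<bullet> w j"
  shows "\<exists>f. bounded_linear f \<and> (\<forall>i\<in>I. f (v i) = w i) \<and> (\<forall>x\<in>S. norm (f x) = norm x)"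
proof -
  let ?V = "span (v ` I)"
  \<comment> \<open>Defining the map on a basis chosen among the \<open>v i\<close> replaces a check
    of well-definedness on the span; \<open>gv\<close> then recovers the prescribed value at every
    index.\<close>
  obtain B where B: "B \<subseteq> v ` I" "independent B" "v ` I \<subseteq> span B"
    using maximal_independent_subset by blast
  have spB: "span B = ?V"
    using span_mono[OF B(1)] span_minimal[OF B(3) subspace_span] by (rule subset_antisym)
  have "\<forall>b\<in>B. \<exists>i. i \<in> I \<and> v i = b" using B(1) by auto
  then obtain c where c: "\<And>b. b \<in> B \<Longrightarrow> c b \<in> I \<and> v (c b) = b" by metis
  obtain g where g: "linear g" and gB: "\<And>b. b \<in> B \<Longrightarrow> g b = w (c b)"
    using linear_independent_extend[OF B(2), of "\<lambda>b. w (c b)"] by blast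
  interpret g: linear g by fact
  have gw: "g x \<bullet> w j = x \<bullet> v j" if "x \<in> ?V" "j \<in> I" for x j
    using that(1) unfolding spB[symmetric]
  proof (induction rule: span_induct_alt)
    case (step a b y)
    then show ?case
      using gram[of "c b" j] c[of b] that(2) by (simp add: g.add g.scaleR gB inner_add_left)
  qed (simp add: g.zero)
  have gg: "g x \<bullet> g y = x \<bullet> y" if "x \<in> ?V" "y \<in> ?V" for x y
    using that(1) unfolding spB[symmetric]
  proof (induction rule: span_induct_alt)
    case (step a b z)
    then show ?case
      using gw[OF that(2), of "c b"] c[of b]
      by (simp add: g.add g.scaleR gB inner_add_left inner_add_right inner_commute)
  qed (simp add: g.zero)
  have gv: "g (v i) = w i" if "i \<in> I" for i
  proof -
    have vi: "v i \<in> ?V" using that by (simp add: span_base)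
    have "(g (v i) - w i) \<bullet> (g (v i) - w i) = 0"
      using gg[OF vi vi] gw[OF vi that] gram[OF that that]
      by (simp add: inner_diff_left inner_diff_right inner_commute)
    then show ?thesis by simp
  qed
  have gn: "norm (g x) = norm x" if "x \<in> ?V" for x
    using gg[OF that that] by (simp add: norm_eq_sqrt_inner)
  have "uniformly_continuous_on ?V g"
    unfolding uniformly_continuous_on_def
  proof (intro allI impI)
    fix e :: real assume "e > 0"
    then show "\<exists>d>0. \<forall>x\<in>?V. \<forall>x'\<in>?V. dist x' x < d \<longrightarrow> dist (g x') (g x) < e"
      using gn by (auto simp: dist_norm g.diff[symmetric] span_diff intro!: exI[of _ e])
  qed
  then obtain h where h: "uniformly_continuous_on (closure ?V) h" "\<And>x. x \<in> ?V \<Longrightarrow> g x = h x"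
    by (rule uniformly_continuous_on_extension_on_closure) blast
  have VS: "closure ?V \<subseteq> S" using S vS by (intro closure_minimal span_minimal) auto
  have VS: "closure ?V = S"
    using VS tot by (intro subset_closed_subspace_total[OF S] subspace_closure subspace_span)
      (auto simp: orth_compl_closure_span orth_compl_iff)
  have hc: "continuous_on S h"
    using h(1) VS uniformly_continuous_imp_continuous by auto
  have seq: "\<exists>s. (\<forall>n. s n \<in> ?V) \<and> s \<longlonglongrightarrow> x \<and> (\<lambda>n. g (s n)) \<longlonglongrightarrow> h x" if x: "x \<in> S" for x
  proof -
    from x VS obtain s where s: "\<And>n. s n \<in> ?V" "s \<longlonglongrightarrow> x"
      unfolding closure_sequential[symmetric] by (metis closure_sequential)
    have "(\<lambda>n. h (s n)) \<longlonglongrightarrow> h x"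
      using hc s x VS closure_subset[of ?V] unfolding continuous_on_sequentially comp_def by blast
    then have "(\<lambda>n. g (s n)) \<longlonglongrightarrow> h x" using h(2)[OF s(1)] by simp
    with s show ?thesis by (intro exI[of _ s]) auto
  qed
  have hadd: "h (x + y) = h x + h y" if xy: "x \<in> S" "y \<in> S" for x y
  proof -
    obtain s where s: "\<And>n. s n \<in> ?V" "s \<longlonglongrightarrow> x" "(\<lambda>n. g (s n)) \<longlonglongrightarrow> h x" using seq xy by meson
    obtain t where t: "\<And>n. t n \<in> ?V" "t \<longlonglongrightarrow> y" "(\<lambda>n. g (t n)) \<longlonglongrightarrow> h y" using seq xy by meson
    have "x + y \<in> S" using xy S by (intro subspace_add)
    moreover have "s n + t n \<in> S" for n using s t VS closure_subset[of ?V] span_add by blast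
    ultimately have "(\<lambda>n. h (s n + t n)) \<longlonglongrightarrow> h (x + y)"
      using hc xy tendsto_add[OF s(2) t(2)] unfolding continuous_on_sequentially comp_def by auto
    moreover have "h (s n + t n) = g (s n) + g (t n)" for n
      using h(2)[of "s n + t n"] s t by (simp add: span_add g.add)
    ultimately show ?thesis
      using tendsto_add[OF s(3) t(3)] LIMSEQ_unique by simp
  qed
  have hscale: "h (r *\<^sub>R x) = r *\<^sub>R h x" if x: "x \<in> S" for r x
  proof -
    obtain s where s: "\<And>n. s n \<in> ?V" "s \<longlonglongrightarrow> x" "(\<lambda>n. g (s n)) \<longlonglongrightarrow> h x" using seq x by meson
    have "r *\<^sub>R x \<in> S" using x S by (intro subspace_scale)
    moreover have "r *\<^sub>R s n \<in> S" for n using s VS closure_subset[of ?V] span_scale by blast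
    ultimately have "(\<lambda>n. h (r *\<^sub>R s n)) \<longlonglongrightarrow> h (r *\<^sub>R x)"
      using hc tendsto_scaleR[OF tendsto_const s(2)]
      unfolding continuous_on_sequentially comp_def by auto
    moreover have "h (r *\<^sub>R s n) = r *\<^sub>R g (s n)" for n
      using h(2)[of "r *\<^sub>R s n"] s by (simp add: span_scale g.scaleR)
    ultimately show ?thesis
      using tendsto_scaleR[OF tendsto_const s(3), of r] LIMSEQ_unique by simp
  qed
  have hnorm: "norm (h x) = norm x" if x: "x \<in> S" for x
  proof -
    obtain s where s: "\<And>n. s n \<in> ?V" "s \<longlonglongrightarrow> x" "(\<lambda>n. g (s n)) \<longlonglongrightarrow> h x" using seq x by meson
    show ?thesis
      using tendsto_norm[OF s(3)] tendsto_norm[OF s(2)] gn[OF s(1)] LIMSEQ_unique by simp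
  qed
  \<comment> \<open>Composing with the projection makes the map on \<open>S\<close> bounded linear
    on the whole type.\<close>
  interpret p: bounded_linear "orth_proj S" by (rule bounded_linear_orth_proj[OF S])
  have "bounded_linear (\<lambda>x. h (orth_proj S x))"
  proof (rule bounded_linear_intro[of _ 1])
    show "norm (h (orth_proj S x)) \<le> norm x * 1" for x
      using hnorm[OF orth_proj_in[OF S]] norm_orth_proj_le[OF S] by simp
  qed (simp_all add: p.add p.scaleR hadd hscale orth_proj_in[OF S])
  moreover have "h (orth_proj S (v i)) = w i" if "i \<in> I" for i
    using that vS gv h(2)[of "v i"] by (simp add: orth_proj_id[OF S] span_base)
  ultimately show ?thesis using hnorm orth_proj_id[OF S] by (intro exI[of _ "\<lambda>x. h (orth_proj S x)"]) auto
qed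

section \<open>Square roots of operators\<close>

text \<open>
  The iterates \<open>Y (n + 1) = (A + (Y n)\<^sup>2) / 2\<close> tend to \<open>1 - sqrt (1 - A)\<close> for every contraction \<open>A\<close>.
  Both \<open>Y n\<close> and \<open>Y (n + 1) - Y n\<close> are polynomials in \<open>A\<close> with nonnegative coefficients, hence
  dominated by their values at \<open>A = 1\<close>; no positivity of \<open>A\<close> is needed.
\<close>

primrec sqrt_scalar_iter :: "nat \<Rightarrow> real" where
  "sqrt_scalar_iter 0 = 0"
| "sqrt_scalar_iter (Suc n) = (1 + (sqrt_scalar_iter n)\<^sup>2) / 2"

lemma sqrt_scalar_iter_bounds: "0 \<le> sqrt_scalar_iter n" "sqrt_scalar_iter n \<le> 1"
proof (induction n)
  case (Suc n)
  show "0 \<le> sqrt_scalar_iter (Suc n)" by simp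
  show "sqrt_scalar_iter (Suc n) \<le> 1"
    using power_le_one[OF Suc] by simp
qed simp_all

lemma sqrt_scalar_iter_incseq: "incseq sqrt_scalar_iter"
proof (rule incseq_SucI)
  fix n
  have "0 \<le> (1 - sqrt_scalar_iter n)\<^sup>2" by simp
  then show "sqrt_scalar_iter n \<le> sqrt_scalar_iter (Suc n)"
    by (simp add: power2_diff)
qed

lemma sqrt_scalar_iter_convergent: "\<exists>t. sqrt_scalar_iter \<longlonglongrightarrow> t"
  using incseq_convergent[OF sqrt_scalar_iter_incseq, of 1] sqrt_scalar_iter_bounds(2) by blast

primrec sqrt_iter :: "('a::real_vector \<Rightarrow> 'a) \<Rightarrow> nat \<Rightarrow> 'a \<Rightarrow> 'a" where
  "sqrt_iter A 0 = (\<lambda>x. 0)"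
| "sqrt_iter A (Suc n) = (\<lambda>x. (1/2) *\<^sub>R (A x + sqrt_iter A n (sqrt_iter A n x)))"

definition sqrt_lim :: "('a::real_normed_vector \<Rightarrow> 'a) \<Rightarrow> 'a \<Rightarrow> 'a" where
  "sqrt_lim A x = lim (\<lambda>n. sqrt_iter A n x)"

lemma sqrt_iter_in:
  assumes "subspace S" "\<And>x. x \<in> S \<Longrightarrow> A x \<in> S" "x \<in> S"
  shows "sqrt_iter A n x \<in> S"
  using assms(3)
  by (induction n arbitrary: x) (auto intro!: subspace_0 subspace_scale subspace_add assms)

text \<open>Stated relative to \<open>S\<close> because the later choices of \<open>C\<close>, a
  unitary and the complex structure, are known to commute with \<open>A\<close> on \<open>S\<close>
  only.\<close>

lemma sqrt_iter_commute:
  assumes "subspace S" "\<And>x. x \<in> S \<Longrightarrow> A x \<in> S" "linear C"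
    and "\<And>x. x \<in> S \<Longrightarrow> C x \<in> S" "\<And>x. x \<in> S \<Longrightarrow> C (A x) = A (C x)" "x \<in> S"
  shows "C (sqrt_iter A n x) = sqrt_iter A n (C x)"
  using assms(6)
proof (induction n arbitrary: x)
  case 0
  then show ?case using linear_0[OF assms(3)] by simp
next
  case (Suc n)
  have "C (sqrt_iter A n (sqrt_iter A n x)) = sqrt_iter A n (sqrt_iter A n (C x))"
    using Suc.IH[OF sqrt_iter_in[OF assms(1,2) Suc.prems]] Suc.IH[OF Suc.prems] by simp
  then show ?case
    by (simp only: sqrt_iter.simps linear_add[OF assms(3)] linear_scale[OF assms(3)] assms(5)[OF Suc.prems])
qed

lemma sqrt_iter_symmetric:
  fixes A :: "'a::real_inner \<Rightarrow> 'a"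
  assumes "subspace S" "\<And>x. x \<in> S \<Longrightarrow> A x \<in> S"
    and "\<And>x y. x \<in> S \<Longrightarrow> y \<in> S \<Longrightarrow> A x \<bullet> y = x \<bullet> A y" and "x \<in> S" "y \<in> S"
  shows "sqrt_iter A n x \<bullet> y = x \<bullet> sqrt_iter A n y"
  using assms(4,5)
proof (induction n arbitrary: x y)
  case (Suc n)
  have "sqrt_iter A n (sqrt_iter A n x) \<bullet> y = x \<bullet> sqrt_iter A n (sqrt_iter A n y)"
    using Suc.IH[OF sqrt_iter_in[OF assms(1,2) Suc.prems(1)] Suc.prems(2)]
      Suc.IH[OF Suc.prems(1) sqrt_iter_in[OF assms(1,2) Suc.prems(2)]] by simp
  then show ?case using Suc.prems assms(3) by (simp add: inner_add_left inner_add_right)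
qed simp

context
  fixes A :: "'a::banach \<Rightarrow> 'a"
  assumes A: "linear A" and A_le: "\<And>x. norm (A x) \<le> norm x"
begin

lemma linear_sqrt_iter: "linear (sqrt_iter A n)"
proof (induction n)
  case (Suc n)
  show ?case
    by (rule linearI) (simp_all add: linear_add[OF A] linear_add[OF Suc]
        linear_scale[OF A] linear_scale[OF Suc] algebra_simps)
qed (simp add: linear_iff)

lemma norm_sqrt_iter_le: "norm (sqrt_iter A n x) \<le> sqrt_scalar_iter n * norm x"
proof (induction n arbitrary: x)
  case (Suc n)
  have "norm (sqrt_iter A n (sqrt_iter A n x)) \<le> sqrt_scalar_iter n * (sqrt_scalar_iter n * norm x)"
    by (rule order_trans[OF Suc mult_left_mono[OF Suc sqrt_scalar_iter_bounds(1)]])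
  with A_le[of x] norm_triangle_ineq[of "A x" "sqrt_iter A n (sqrt_iter A n x)"]
  show ?case by (simp add: power2_eq_square distrib_right add_divide_distrib mult.assoc)
qed simp

lemma norm_sqrt_iter_contraction: "norm (sqrt_iter A n x) \<le> norm x"
  using norm_sqrt_iter_le[of n x] sqrt_scalar_iter_bounds[of n]
    mult_right_mono[of "sqrt_scalar_iter n" 1 "norm x"] by simp

lemma sqrt_iter_sqrt_iter: "sqrt_iter A m (sqrt_iter A n x) = sqrt_iter A n (sqrt_iter A m x)"
proof (rule sqrt_iter_commute[where S = UNIV])
  fix x :: 'a
  show "sqrt_iter A m (A x) = A (sqrt_iter A m x)"
    by (rule sqrt_iter_commute[where S = UNIV, symmetric]) (simp_all add: A)
qed (simp_all add: linear_sqrt_iter)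

text \<open>The iterates commute, so the difference of squares factors as
  \<open>(Z - Y) Z + (Z - Y) Y\<close>. Bounding each factor by its scalar counterpart reproduces
  the scalar recursion exactly.\<close>

lemma norm_sqrt_iter_Suc_diff:
  "norm (sqrt_iter A (Suc n) x - sqrt_iter A n x)
    \<le> (sqrt_scalar_iter (Suc n) - sqrt_scalar_iter n) * norm x"
proof (induction n arbitrary: x)
  case 0
  then show ?case using A_le by simp
next
  case (Suc n)
  let ?Y = "sqrt_iter A n" and ?Z = "sqrt_iter A (Suc n)"
  let ?s = "sqrt_scalar_iter n" and ?t = "sqrt_scalar_iter (Suc n)"
  have st: "?s \<le> ?t" using sqrt_scalar_iter_incseq by (simp add: incseq_Suc_iff del: sqrt_scalar_iter.simps)
  have split: "sqrt_iter A (Suc (Suc n)) x - ?Z x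
      = (1/2) *\<^sub>R ((?Z (?Z x) - ?Y (?Z x)) + (?Z (?Y x) - ?Y (?Y x)))"
  proof -
    have "sqrt_iter A (Suc (Suc n)) x - ?Z x
      = (1/2) *\<^sub>R (A x + ?Z (?Z x)) - (1/2) *\<^sub>R (A x + ?Y (?Y x))"
    by simp
    then show ?thesis
      unfolding sqrt_iter_sqrt_iter[of n "Suc n" x]
      by (simp add: algebra_simps del: sqrt_iter.simps)
  qed
  have "norm (sqrt_iter A (Suc (Suc n)) x - ?Z x) \<le> (1/2) * (norm (?Z (?Z x) - ?Y (?Z x)) + norm (?Z (?Y x) - ?Y (?Y x)))"
    unfolding split norm_scaleR by (rule mult_mono[OF _ norm_triangle_ineq]) simp_all
  also have "\<dots> \<le> (1/2) * ((?t - ?s) * (?t * norm x) + (?t - ?s) * (?s * norm x))"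
  proof (rule mult_left_mono[OF add_mono])
    show "norm (?Z (?Z x) - ?Y (?Z x)) \<le> (?t - ?s) * (?t * norm x)"
      by (rule order_trans[OF Suc mult_left_mono[OF norm_sqrt_iter_le]]) (use st in simp)
    show "norm (?Z (?Y x) - ?Y (?Y x)) \<le> (?t - ?s) * (?s * norm x)"
      by (rule order_trans[OF Suc mult_left_mono[OF norm_sqrt_iter_le]]) (use st in simp)
  qed simp
  also have "\<dots> = (((1 + ?t\<^sup>2) / 2) - ((1 + ?s\<^sup>2) / 2)) * norm x"
    by (simp add: power2_eq_square algebra_simps del: sqrt_scalar_iter.simps)
  finally show ?case by simp
qed

lemma norm_sqrt_iter_diff:
  "n \<le> m \<Longrightarrow> norm (sqrt_iter A m x - sqrt_iter A n x)
    \<le> (sqrt_scalar_iter m - sqrt_scalar_iter n) * norm x"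
proof (induction m rule: dec_induct)
  case (step m)
  have "norm (sqrt_iter A (Suc m) x - sqrt_iter A n x)
      \<le> norm (sqrt_iter A (Suc m) x - sqrt_iter A m x) + norm (sqrt_iter A m x - sqrt_iter A n x)"
    using norm_triangle_ineq[of "sqrt_iter A (Suc m) x - sqrt_iter A m x"
        "sqrt_iter A m x - sqrt_iter A n x"] by (simp del: sqrt_iter.simps)
  also have "\<dots> \<le> (sqrt_scalar_iter (Suc m) - sqrt_scalar_iter m) * norm x
      + (sqrt_scalar_iter m - sqrt_scalar_iter n) * norm x"
    by (intro add_mono norm_sqrt_iter_Suc_diff step)
  finally show ?case by (simp add: algebra_simps del: sqrt_iter.simps sqrt_scalar_iter.simps)
qed simp

lemma sqrt_iter_tendsto: "(\<lambda>n. sqrt_iter A n x) \<longlonglongrightarrow> sqrt_lim A x"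
proof -
  obtain t where t: "sqrt_scalar_iter \<longlonglongrightarrow> t" using sqrt_scalar_iter_convergent by blast
  have le: "sqrt_scalar_iter n \<le> t" for n
    by (rule incseq_le[OF sqrt_scalar_iter_incseq t])
  have t': "(\<lambda>n. (t - sqrt_scalar_iter n) * norm x) \<longlonglongrightarrow> 0"
    using tendsto_mult[OF tendsto_diff[OF tendsto_const t] tendsto_const, of t "norm x"] by simp
  have "Cauchy (\<lambda>n. sqrt_iter A n x)"
    unfolding Cauchy_altdef2
  proof (intro allI impI)
    fix e :: real assume "e > 0"
    from order_tendstoD(2)[OF t' this]
    obtain N where N: "(t - sqrt_scalar_iter N) * norm x < e"
      by (auto simp: eventually_sequentially)
    have "dist (sqrt_iter A n x) (sqrt_iter A N x) < e" if "n \<ge> N" for n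
    proof -
      have "norm (sqrt_iter A n x - sqrt_iter A N x) \<le> (t - sqrt_scalar_iter N) * norm x"
        by (rule order_trans[OF norm_sqrt_iter_diff[OF that]]) (use le in \<open>simp add: mult_right_mono\<close>)
      with N show ?thesis by (simp add: dist_norm)
    qed
    then show "\<exists>N. \<forall>n\<ge>N. dist (sqrt_iter A n x) (sqrt_iter A N x) < e" by blast
  qed
  then show ?thesis
    unfolding sqrt_lim_def using Cauchy_convergent convergent_LIMSEQ_iff by blast
qed

lemma bounded_linear_sqrt_lim: "bounded_linear (sqrt_lim A)"
proof (rule bounded_linear_intro[of _ 1])
  show "sqrt_lim A (x + y) = sqrt_lim A x + sqrt_lim A y" for x y
    using sqrt_iter_tendsto[of "x + y"] tendsto_add[OF sqrt_iter_tendsto[of x] sqrt_iter_tendsto[of y]]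
    by (simp add: linear_add[OF linear_sqrt_iter] LIMSEQ_unique)
  show "sqrt_lim A (r *\<^sub>R x) = r *\<^sub>R sqrt_lim A x" for r x
    using sqrt_iter_tendsto[of "r *\<^sub>R x"] tendsto_scaleR[OF tendsto_const sqrt_iter_tendsto[of x]]
    by (simp add: linear_scale[OF linear_sqrt_iter] LIMSEQ_unique)
  show "norm (sqrt_lim A x) \<le> norm x * 1" for x
    using LIMSEQ_le_const2[OF tendsto_norm[OF sqrt_iter_tendsto[of x]], of "norm x"]
      norm_sqrt_iter_contraction by auto
qed

text \<open>With \<open>L\<close> for the limit this reads \<open>(1 - L)^2 = 1 - A\<close>, so
  \<open>1 - L\<close> is the desired square root.\<close>

lemma sqrt_lim_fixpoint: "2 *\<^sub>R sqrt_lim A x = A x + sqrt_lim A (sqrt_lim A x)"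
proof -
  let ?Y = "sqrt_iter A" and ?L = "sqrt_lim A"
  have d: "(\<lambda>n. ?Y n x - ?L x) \<longlonglongrightarrow> 0"
    using tendsto_diff[OF sqrt_iter_tendsto[of x] tendsto_const[of "?L x"]] by simp
  \<comment> \<open>Both the operator and its argument vary with \<open>n\<close>; since all
    \<open>?Y n\<close> are contractions, replacing the argument by its limit costs an error that
    tends to zero.\<close>
  have "(\<lambda>n. ?Y n (?Y n x - ?L x)) \<longlonglongrightarrow> 0"
    by (rule Lim_null_comparison[OF _ tendsto_norm_zero[OF d]]) (simp add: norm_sqrt_iter_contraction)
  from tendsto_add[OF this sqrt_iter_tendsto[of "?L x"]]
  have "(\<lambda>n. ?Y n (?Y n x)) \<longlonglongrightarrow> ?L (?L x)"
    by (simp add: linear_diff[OF linear_sqrt_iter])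
  then have "(\<lambda>n. ?Y (Suc n) x) \<longlonglongrightarrow> (1/2) *\<^sub>R (A x + ?L (?L x))"
    by (auto intro!: tendsto_intros)
  then have "?L x = (1/2) *\<^sub>R (A x + ?L (?L x))"
    using LIMSEQ_Suc[OF sqrt_iter_tendsto[of x]] LIMSEQ_unique by blast
  then show ?thesis by (metis scaleR_half_double scaleR_2 scaleR_right_distrib)
qed

lemma sqrt_lim_in:
  assumes "subspace S" "closed S" "\<And>x. x \<in> S \<Longrightarrow> A x \<in> S" "x \<in> S"
  shows "sqrt_lim A x \<in> S"
  by (rule closed_sequentially[OF assms(2) _ sqrt_iter_tendsto]) (simp add: sqrt_iter_in assms)

lemma sqrt_lim_commute:
  assumes "subspace S" "\<And>x. x \<in> S \<Longrightarrow> A x \<in> S" "bounded_linear C"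
    and "\<And>x. x \<in> S \<Longrightarrow> C x \<in> S" "\<And>x. x \<in> S \<Longrightarrow> C (A x) = A (C x)" "x \<in> S"
  shows "C (sqrt_lim A x) = sqrt_lim A (C x)"
proof -
  have "(\<lambda>n. C (sqrt_iter A n x)) \<longlonglongrightarrow> C (sqrt_lim A x)"
    by (rule bounded_linear.tendsto[OF assms(3) sqrt_iter_tendsto])
  moreover have "C (sqrt_iter A n x) = sqrt_iter A n (C x)" for n
    by (rule sqrt_iter_commute[where S = S]) (use assms bounded_linear.linear[OF assms(3)] in auto)
  ultimately show ?thesis using sqrt_iter_tendsto[of "C x"] LIMSEQ_unique by simp
qed

end

lemma sqrt_lim_symmetric:
  fixes A :: "'a::{real_inner,banach} \<Rightarrow> 'a"
  assumes "linear A" "\<And>x. norm (A x) \<le> norm x"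
    and "subspace S" "\<And>x. x \<in> S \<Longrightarrow> A x \<in> S"
    and "\<And>x y. x \<in> S \<Longrightarrow> y \<in> S \<Longrightarrow> A x \<bullet> y = x \<bullet> A y" and "x \<in> S" "y \<in> S"
  shows "sqrt_lim A x \<bullet> y = x \<bullet> sqrt_lim A y"
  using tendsto_inner[OF sqrt_iter_tendsto[OF assms(1,2), of x] tendsto_const[of y]]
    tendsto_inner[OF tendsto_const[of x] sqrt_iter_tendsto[OF assms(1,2), of y]]
  by (simp add: sqrt_iter_symmetric[OF assms(3-7)] LIMSEQ_unique)

section \<open>Unitary operators\<close>

text \<open>A complex Hilbert space is handled as a real one with multiplication by \<open>\<i>\<close> as extra structure
  \<open>J\<close>, since the real part of the inner product determines it.\<close>

locale complex_structure =
  fixes J :: "'a::{real_inner,banach} \<Rightarrow> 'a"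
  assumes bounded_linear_J: "bounded_linear J"
    and J_J: "J (J x) = - x"
    and norm_J: "norm (J x) = norm x"
begin

lemmas linear_J = bounded_linear.linear[OF bounded_linear_J]
lemmas J_add = linear_add[OF linear_J]
  and J_diff = linear_diff[OF linear_J]
  and J_neg = linear_neg[OF linear_J]
  and J_scaleR = linear_scale[OF linear_J]
  and J_zero = linear_0[OF linear_J]

lemma inner_J: "J x \<bullet> J y = x \<bullet> y"
  by (simp add: inner_polarization[of "J x"] inner_polarization[of x] J_add[symmetric] norm_J)

lemma inner_J_left: "J x \<bullet> y = - (x \<bullet> J y)"
  using inner_J[of x "J y"] by (simp add: J_J)

definition closed_csubspace :: "'a set \<Rightarrow> bool" where
  "closed_csubspace S \<longleftrightarrow> subspace S \<and> closed S \<and> (\<forall>x\<in>S. J x \<in> S)"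

lemma closed_csubspaceD: "closed_csubspace S \<Longrightarrow> subspace S" "closed_csubspace S \<Longrightarrow> closed S" "closed_csubspace S \<Longrightarrow> x \<in> S \<Longrightarrow> J x \<in> S"
  by (auto simp: closed_csubspace_def)

text \<open>Operators on a subspace are total functions; their values elsewhere are irrelevant.\<close>

definition unitary_on :: "'a set \<Rightarrow> ('a \<Rightarrow> 'a) \<Rightarrow> bool" where
  "unitary_on S f \<longleftrightarrow> bounded_linear f \<and>
     (\<forall>x\<in>S. f x \<in> S \<and> norm (f x) = norm x \<and> f (J x) = J (f x)) \<and> (\<forall>y\<in>S. \<exists>x\<in>S. f x = y)"

lemma unitary_onD:
  assumes "unitary_on S f"
  shows "bounded_linear f" "x \<in> S \<Longrightarrow> f x \<in> S" "x \<in> S \<Longrightarrow> norm (f x) = norm x"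
    "x \<in> S \<Longrightarrow> f (J x) = J (f x)" "y \<in> S \<Longrightarrow> \<exists>x\<in>S. f x = y"
  using assms by (auto simp: unitary_on_def)

lemma unitary_on_inner:
  assumes "closed_csubspace S" "unitary_on S f" "x \<in> S" "y \<in> S"
  shows "f x \<bullet> f y = x \<bullet> y"
proof -
  interpret f: bounded_linear f by (rule unitary_onD(1)[OF assms(2)])
  have "x + y \<in> S" using assms closed_csubspaceD(1) by (blast intro: subspace_add)
  then show ?thesis
    using unitary_onD(3)[OF assms(2)] assms
    by (simp add: inner_polarization[of "f x"] inner_polarization[of x] f.add[symmetric])
qed

text \<open>Adjoining the vectors \<open>J (v i)\<close> (index set \<open>I \<times> UNIV\<close>,
  the flag marking \<open>J\<close>) turns the complex Gram data into real data for
  \<open>isometry_extension\<close>. That lemma is applied in both directions, and the map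
  \<open>g\<close> from \<open>w\<close> back to \<open>v\<close> shows that \<open>f\<close> is
  onto.\<close>

lemma unitary_extension:
  fixes v w :: "'i \<Rightarrow> 'a"
  assumes S: "closed_csubspace S" and v: "\<And>i. i \<in> I \<Longrightarrow> v i \<in> S" and w: "\<And>i. i \<in> I \<Longrightarrow> w i \<in> S"
    and totv: "\<And>y. y \<in> S \<Longrightarrow> (\<And>i. i \<in> I \<Longrightarrow> y \<bullet> v i = 0 \<and> y \<bullet> J (v i) = 0) \<Longrightarrow> y = 0"
    and totw: "\<And>y. y \<in> S \<Longrightarrow> (\<And>i. i \<in> I \<Longrightarrow> y \<bullet> w i = 0 \<and> y \<bullet> J (w i) = 0) \<Longrightarrow> y = 0"
    and gram: "\<And>i j. i \<in> I \<Longrightarrow> j \<in> I \<Longrightarrow> v i \<bullet> v j = w i \<bullet> w j"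
      "\<And>i j. i \<in> I \<Longrightarrow> j \<in> I \<Longrightarrow> v i \<bullet> J (v j) = w i \<bullet> J (w j)"
  shows "\<exists>f. unitary_on S f \<and> (\<forall>i\<in>I. f (v i) = w i)"
proof -
  note SS = closed_csubspaceD(1,2)[OF S]
  define d where "d u = (\<lambda>(i, b). if b then J (u i) else u i)" for u :: "'i \<Rightarrow> 'a"
  let ?K = "I \<times> (UNIV :: bool set)"
  have dS: "d u p \<in> S" if "\<And>i. i \<in> I \<Longrightarrow> u i \<in> S" "p \<in> ?K" for u p
    using that closed_csubspaceD(3)[OF S] by (auto simp: d_def split: prod.splits)
  have dvS: "d v p \<in> S" and dwS: "d w p \<in> S" if "p \<in> ?K" for p
    using that v w by (auto intro!: dS)
  have dtot: "y = 0" if "\<And>y. y \<in> S \<Longrightarrow> (\<And>i. i \<in> I \<Longrightarrow> y \<bullet> u i = 0 \<and> y \<bullet> J (u i) = 0) \<Longrightarrow> y = 0"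
    "y \<in> S" "\<And>p. p \<in> ?K \<Longrightarrow> y \<bullet> d u p = 0" for u y
    using that(2) that(3)[of "(_, True)"] that(3)[of "(_, False)"]
    by (intro that(1)) (auto simp: d_def)
  have dgram: "d v p \<bullet> d v q = d w p \<bullet> d w q" if "p \<in> ?K" "q \<in> ?K" for p q
    using that by (auto simp: d_def inner_J inner_J_left gram J_J)
  obtain f where f: "bounded_linear f" "\<And>p. p \<in> ?K \<Longrightarrow> f (d v p) = d w p"
    "\<And>x. x \<in> S \<Longrightarrow> norm (f x) = norm x"
  proof -
    have "\<exists>f. bounded_linear f \<and> (\<forall>p\<in>?K. f (d v p) = d w p) \<and> (\<forall>x\<in>S. norm (f x) = norm x)"
      by (rule isometry_extension[OF SS dvS dtot[OF totv] dgram])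
    then show ?thesis using that by blast
  qed
  obtain g where g: "bounded_linear g" "\<And>p. p \<in> ?K \<Longrightarrow> g (d w p) = d v p"
  proof -
    have "\<exists>f. bounded_linear f \<and> (\<forall>p\<in>?K. f (d w p) = d v p) \<and> (\<forall>x\<in>S. norm (f x) = norm x)"
      by (rule isometry_extension[OF SS dwS dtot[OF totw] dgram[symmetric]])
    then show ?thesis using that by blast
  qed
  \<comment> \<open>The vectors of \<open>S\<close> that are sent into \<open>S\<close> form a
    closed subspace containing a total family.\<close>
  have into: "h x \<in> S" if h: "bounded_linear h" and hd: "\<And>p. p \<in> ?K \<Longrightarrow> h (d u p) \<in> S"
    and u: "\<And>i. i \<in> I \<Longrightarrow> u i \<in> S"
      "\<And>y. y \<in> S \<Longrightarrow> (\<And>i. i \<in> I \<Longrightarrow> y \<bullet> u i = 0 \<and> y \<bullet> J (u i) = 0) \<Longrightarrow> y = 0"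
    and x: "x \<in> S" for h u x
  proof -
    have "S \<inter> h -` S = S"
    proof (rule subset_closed_subspace_total[OF SS])
      show "subspace (S \<inter> h -` S)"
        by (intro subspace_inter SS linear_subspace_vimage bounded_linear.linear[OF h])
      show "closed (S \<inter> h -` S)"
        by (intro closed_Int SS continuous_closed_vimage linear_continuous_at h)
      show "y = 0" if y: "y \<in> S" "y \<in> orth_compl (S \<inter> h -` S)" for y
      proof (rule dtot[where u = u])
        show "y \<bullet> d u p = 0" if "p \<in> ?K" for p
          using y(2) hd[OF that] dS[OF u(1) that] by (simp add: orth_compl_iff)
      qed (use u(2) y(1) in auto)
    qed blast
    with x show ?thesis by blast
  qed
  have gS: "g y \<in> S" if "y \<in> S" for y
    by (rule into[OF g(1), where u = w]) (use w totw that in \<open>auto simp: g(2) dvS\<close>)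
  have fS: "f y \<in> S" if "y \<in> S" for y
    by (rule into[OF f(1), where u = v]) (use v totv that in \<open>auto simp: f(2) dwS\<close>)
  have fg: "f (g y) = y" if "y \<in> S" for y
  proof (rule bounded_linear_eq_on_total[OF SS, where A = "d w ` ?K" and f = "\<lambda>x. f (g x)" and g = "\<lambda>x. x"])
    show "d w ` ?K \<subseteq> S" using dwS by blast
    show "y = 0" if "y \<in> S" "y \<in> orth_compl (d w ` ?K)" for y
      using that by (intro dtot[OF totw, where y = y]) (auto simp: orth_compl_iff)
    show "bounded_linear (\<lambda>x. f (g x))" by (rule bounded_linear_compose[OF f(1) g(1)])
    show "f (g x) = x" if "x \<in> d w ` ?K" for x using that f(2) g(2) by auto
  qed (use that in \<open>auto intro: bounded_linear_ident\<close>)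
  have fJ: "f (J x) = J (f x)" if "x \<in> S" for x
  proof (rule bounded_linear_eq_on_total[OF SS, where A = "d v ` ?K" and f = "\<lambda>x. f (J x)" and g = "\<lambda>x. J (f x)"])
    show "d v ` ?K \<subseteq> S" using dvS by blast
    show "y = 0" if "y \<in> S" "y \<in> orth_compl (d v ` ?K)" for y
      using that by (intro dtot[OF totv, where y = y]) (auto simp: orth_compl_iff)
    show "bounded_linear (\<lambda>x. f (J x))" by (rule bounded_linear_compose[OF f(1) bounded_linear_J])
    show "bounded_linear (\<lambda>x. J (f x))" by (rule bounded_linear_compose[OF bounded_linear_J f(1)])
    fix x assume "x \<in> d v ` ?K"
    then obtain i b where ib: "i \<in> I" "x = d v (i, b)" by auto
    have "f (v i) = w i" "f (J (v i)) = J (w i)"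
      using f(2)[of "(i, False)"] f(2)[of "(i, True)"] ib by (simp_all add: d_def)
    then show "f (J x) = J (f x)"
      using ib by (simp add: d_def J_J linear_neg[OF bounded_linear.linear[OF f(1)]])
  qed (rule that)
  have "\<forall>i\<in>I. f (v i) = w i"
    using f(2)[of "(_, False)"] by (auto simp: d_def)
  moreover have "unitary_on S f"
    unfolding unitary_on_def using f(1,3) fS fg fJ gS by blast
  ultimately show ?thesis by blast
qed

text \<open>The inverse is the extension of the assignment of \<open>i\<close> to
  \<open>V i\<close>, with \<open>S\<close> itself as index set; this yields a map that is bounded
  linear on the whole type.\<close>

lemma unitary_inverse:
  assumes S: "closed_csubspace S" and V: "unitary_on S V"
  shows "\<exists>V'. unitary_on S V' \<and> (\<forall>x\<in>S. V' (V x) = x \<and> V (V' x) = x)"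
proof -
  note VD = unitary_onD[OF V]
  have "\<exists>f. unitary_on S f \<and> (\<forall>i\<in>S. f (V i) = i)"
  proof (rule unitary_extension[OF S])
    fix y assume "y \<in> S" and y: "\<And>i. i \<in> S \<Longrightarrow> y \<bullet> V i = 0 \<and> y \<bullet> J (V i) = 0"
    obtain x where "x \<in> S" "V x = y" using VD(5)[OF \<open>y \<in> S\<close>] by blast
    with y[of x] show "y = 0" by simp
  next
    fix y assume "y \<in> S" and y: "\<And>i. i \<in> S \<Longrightarrow> y \<bullet> i = 0 \<and> y \<bullet> J i = 0"
    then have "y \<bullet> y = 0" by blast
    then show "y = 0" by simp
  next
    fix x y assume "x \<in> S" "y \<in> S"
    then show "V x \<bullet> V y = x \<bullet> y" "V x \<bullet> J (V y) = x \<bullet> J y"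
      using unitary_on_inner[OF S V] closed_csubspaceD(3)[OF S] VD(4) by metis+
  qed (use VD in auto)
  then obtain f where f: "unitary_on S f" "\<And>x. x \<in> S \<Longrightarrow> f (V x) = x" by blast
  moreover have "V (f x) = x" if "x \<in> S" for x
    using VD(5)[OF that] f(2) by metis
  ultimately show ?thesis by blast
qed

theorem unitary_sqrt:
  assumes S: "closed_csubspace S" and V: "unitary_on S V"
  shows "\<exists>W. unitary_on S W \<and> (\<forall>x\<in>S. W (W x) = V x)"
proof -
  note SS = closed_csubspaceD(1,2)[OF S] and SJ = closed_csubspaceD(3)[OF S] and VD = unitary_onD[OF V]
  obtain V' where V': "unitary_on S V'" and inv: "\<And>x. x \<in> S \<Longrightarrow> V' (V x) = x" "\<And>x. x \<in> S \<Longrightarrow> V (V' x) = x"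
    using unitary_inverse[OF S V] by blast
  note VD' = unitary_onD[OF V']
  interpret V: bounded_linear V by (rule VD(1))
  interpret V': bounded_linear V' by (rule VD'(1))
  interpret p: bounded_linear "orth_proj S" by (rule bounded_linear_orth_proj[OF SS])
  have V_adj: "V x \<bullet> y = x \<bullet> V' y" if "x \<in> S" "y \<in> S" for x y
    using unitary_on_inner[OF S V, of x "V' y"] that inv VD'(2) by simp
  note SI = subspace_add[OF SS(1)] subspace_diff[OF SS(1)] subspace_scale[OF SS(1)]
    subspace_0[OF SS(1)]
  \<comment> \<open>Chosen so that on \<open>S\<close> the operator \<open>1 - A\<close> is
    \<open>(2 + V + V') / 4\<close>, a quarter of \<open>(1 + V)\<^sup>* (1 + V)\<close>. The
    projection makes \<open>A\<close> a contraction everywhere. The factor 2 in \<open>P\<close>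
    below undoes the quarter.\<close>
  define A where "A x = (1/4) *\<^sub>R (2 *\<^sub>R orth_proj S x - V (orth_proj S x) - V' (orth_proj S x))" for x
  have A_S: "A x = (1/4) *\<^sub>R (2 *\<^sub>R x - V x - V' x)" if "x \<in> S" for x
    by (simp add: A_def orth_proj_id[OF SS that])
  have A: "bounded_linear A"
    unfolding A_def
    by (intro bounded_linear_const_scaleR bounded_linear_sub p.bounded_linear_axioms
        bounded_linear_compose[OF VD(1)] bounded_linear_compose[OF VD'(1)])
  have A_le: "norm (A x) \<le> norm x" for x
  proof -
    let ?y = "orth_proj S x"
    have y: "?y \<in> S" by (rule orth_proj_in[OF SS])
    have "norm (2 *\<^sub>R ?y - V ?y - V' ?y) \<le> norm (2 *\<^sub>R ?y - V ?y) + norm (V' ?y)"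
      by (rule norm_triangle_ineq4)
    also have "norm (2 *\<^sub>R ?y - V ?y) \<le> norm (2 *\<^sub>R ?y) + norm (V ?y)"
      by (rule norm_triangle_ineq4)
    finally have "norm (A x) \<le> norm ?y"
      using VD(3)[OF y] VD'(3)[OF y] by (simp add: A_def)
    then show ?thesis using norm_orth_proj_le[OF SS, of x] by simp
  qed
  have AS: "A x \<in> S" if "x \<in> S" for x
    using that by (auto simp: A_S intro!: SI VD(2) VD'(2))
  have A_sym: "A x \<bullet> y = x \<bullet> A y" if "x \<in> S" "y \<in> S" for x y
    using V_adj[of x y] V_adj[of y x] that
    by (simp add: A_S inner_diff_left inner_diff_right inner_commute algebra_simps)
  define L where "L = sqrt_lim A"
  note AL = bounded_linear.linear[OF A] A_le
  interpret L: bounded_linear L unfolding L_def by (rule bounded_linear_sqrt_lim[OF AL])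
  have L_fix: "2 *\<^sub>R L x = A x + L (L x)" for x
    unfolding L_def by (rule sqrt_lim_fixpoint[OF AL])
  have LS: "L x \<in> S" if "x \<in> S" for x
    unfolding L_def by (rule sqrt_lim_in[OF AL SS AS that])
  have L_sym: "L x \<bullet> y = x \<bullet> L y" if "x \<in> S" "y \<in> S" for x y
    unfolding L_def by (rule sqrt_lim_symmetric[OF AL SS(1) AS A_sym that])
  have LV: "V (L x) = L (V x)" if "x \<in> S" for x
    unfolding L_def using that
    by (intro sqrt_lim_commute[OF AL SS(1) AS VD(1)])
      (auto simp: A_S VD(2) inv V.scaleR V.diff)
  have LJ: "J (L x) = L (J x)" if "x \<in> S" for x
    unfolding L_def using that
    by (intro sqrt_lim_commute[OF AL SS(1) AS bounded_linear_J])
      (auto simp: A_S SJ VD(4) VD'(4) J_scaleR J_diff)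
  define P where "P x = 2 *\<^sub>R (x - L x)" for x
  have P: "bounded_linear P"
    unfolding P_def
    by (intro bounded_linear_const_scaleR bounded_linear_sub bounded_linear_ident L.bounded_linear_axioms)
  interpret P: bounded_linear P by (rule P)
  have PS: "P x \<in> S" if "x \<in> S" for x using that by (auto simp: P_def intro!: SI LS)
  have PP: "P (P x) = 2 *\<^sub>R x + V x + V' x" if "x \<in> S" for x
  proof -
    have "P (P x) = 4 *\<^sub>R (x - 2 *\<^sub>R L x + L (L x))"
      by (simp add: P_def L.scaleR L.diff algebra_simps) (simp add: scaleR_add_left[symmetric] L.add[symmetric])
    also have "\<dots> = 4 *\<^sub>R (x - A x)" by (simp add: L_fix)
    also have "\<dots> = 4 *\<^sub>R x - (2 *\<^sub>R x - V x - V' x)"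
      by (simp add: A_S[OF that] scaleR_diff_right[of 4 x])
    also have "\<dots> = 2 *\<^sub>R x + V x + V' x"
      using scaleR_add_left[of 2 2 x] by (simp add: algebra_simps)
    finally show ?thesis .
  qed
  have P_sym: "P x \<bullet> y = x \<bullet> P y" if "x \<in> S" "y \<in> S" for x y
    using L_sym[OF that] by (simp add: P_def inner_diff_left inner_diff_right)
  have PV: "V (P x) = P (V x)" if "x \<in> S" for x
    using LV[OF that] by (simp add: P_def V.scaleR V.diff)
  have PJ: "J (P x) = P (J x)" if "x \<in> S" for x
    using LJ[OF that] by (simp add: P_def J_scaleR J_diff)
  define N where "N = {z \<in> S. P z = 0}"
  have N: "z \<in> S" "P z = 0" if "z \<in> N" for z using that by (auto simp: N_def)
  have N0: "0 \<in> N" by (simp add: N_def SI P.zero)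
  have NJ: "J z \<in> N" if "z \<in> N" for z
    using that PJ[of z] by (auto simp: N_def SJ J_zero)
  \<comment> \<open>Polarized form of \<open>P^2 = (1 + V)\<^sup>* (1 + V)\<close>. It makes the
    assignment of \<open>(1 + V) x\<close> to \<open>P x\<close> isometric and shows that
    \<open>1 + V\<close> vanishes on \<open>N\<close>.\<close>
  have one_plus_V: "(x + V x) \<bullet> (y + V y) = P x \<bullet> P y" if "x \<in> S" "y \<in> S" for x y
  proof -
    have "P x \<bullet> P y = x \<bullet> P (P y)" using that by (simp add: P_sym PS)
    then show ?thesis using that
      by (simp add: PP V_adj VD(2) inv unitary_on_inner[OF S V] inner_add_left inner_add_right)
  qed
  have NV: "V z = - z" "V' z = - z" if "z \<in> N" for z
  proof -
    have "(z + V z) \<bullet> (z + V z) = 0"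
      using one_plus_V[of z z] N[OF that] by simp
    then show *: "V z = - z" by (simp add: eq_neg_iff_add_eq_0 add.commute)
    show "V' z = - z" using inv(1)[OF N(1)[OF that]] unfolding * by (simp add: V'.neg) (metis minus_minus)
  qed
  have in_N: "y \<in> N" if "y \<in> S" "P (P y) = 0" for y
    using that P_sym[OF PS that(1), of y] PS by (simp add: N_def)
  \<comment> \<open>The range of \<open>P\<close> and its kernel \<open>N\<close> are orthogonal and
    together total in \<open>S\<close>, so prescribing \<open>w\<close> on \<open>v\<close>
    determines the root.\<close>
  define v where "v = (\<lambda>(x, z). P x + z)"
  define w where "w = (\<lambda>(x, z). (x + V x) + J z)"
  have gram: "v p \<bullet> v q = w p \<bullet> w q" if "p \<in> S \<times> N" "q \<in> S \<times> N" for p q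
  proof -
    obtain x z x' z' where eq: "p = (x, z)" "q = (x', z')" by (metis surj_pair)
    have m: "x \<in> S" "z \<in> N" "x' \<in> S" "z' \<in> N" using that eq by auto
    have 1: "P a \<bullet> c = 0" if "a \<in> S" "c \<in> N" for a c
      using P_sym[OF that(1) N(1)[OF that(2)]] N(2)[OF that(2)] by simp
    have 2: "(a + V a) \<bullet> J c = 0" if "a \<in> S" "c \<in> N" for a c
      using V_adj[OF that(1) N(1)[OF NJ[OF that(2)]]] NV(2)[OF NJ[OF that(2)]]
      by (simp add: inner_add_left)
    have "v p \<bullet> v q = P x \<bullet> P x' + z \<bullet> z'"
      using 1[OF m(1,4)] 1[OF m(3,2)]
      by (simp add: eq v_def inner_add_left inner_add_right inner_commute[of z])
    also have "\<dots> = (x + V x) \<bullet> (x' + V x') + J z \<bullet> J z'"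
      by (simp only: one_plus_V[OF m(1,3)] inner_J)
    also have "\<dots> = w p \<bullet> w q"
      using 2[OF m(1,4)] 2[OF m(3,2)]
      unfolding eq w_def prod.case inner_add_left[of "x + V x"] inner_add_right[of _ "x' + V x'"]
      by (simp add: inner_commute[of "J z"])
    finally show ?thesis .
  qed
  define d where "d = (\<lambda>(x, z). (J x, J z))"
  have dK: "d p \<in> S \<times> N" if "p \<in> S \<times> N" for p using that SJ NJ by (auto simp: d_def)
  have Jv: "J (v p) = v (d p)" if "p \<in> S \<times> N" for p
    using that PJ by (auto simp: v_def d_def J_add)
  have Jw: "J (w p) = w (d p)" if "p \<in> S \<times> N" for p
    using that VD(4) by (auto simp: w_def d_def J_add)
  have "\<exists>W. unitary_on S W \<and> (\<forall>p\<in>S \<times> N. W (v p) = w p)"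
  proof (rule unitary_extension[OF S])
    show "v p \<in> S" if "p \<in> S \<times> N" for p using that by (auto simp: v_def intro!: SI(1) PS intro: N(1))
    show "w p \<in> S" if "p \<in> S \<times> N" for p using that by (auto simp: w_def intro!: SI(1) VD(2) SJ intro: N(1))
    show "y = 0" if y: "y \<in> S" and orth: "\<And>p. p \<in> S \<times> N \<Longrightarrow> y \<bullet> v p = 0 \<and> y \<bullet> J (v p) = 0" for y
    proof -
      \<comment> \<open>The test vector is \<open>P\<close> applied four times to \<open>y\<close>;
        by symmetry its inner product with \<open>y\<close> is the squared norm of
        \<open>P (P y)\<close>.\<close>
      have "P (P y) \<bullet> P (P y) = y \<bullet> P (P (P (P y)))" using y by (simp add: P_sym PS)
      also have "\<dots> = 0" using orth[of "(P (P (P y)), 0)"] y N0 by (simp add: v_def PS)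
      finally have "y \<in> N" using in_N[OF y] by simp
      then show "y = 0" using orth[of "(0, y)"] y by (simp add: v_def SI P.zero)
    qed
    show "y = 0" if y: "y \<in> S" and orth: "\<And>p. p \<in> S \<times> N \<Longrightarrow> y \<bullet> w p = 0 \<and> y \<bullet> J (w p) = 0" for y
    proof -
      \<comment> \<open>\<open>1 + V'\<close> is the adjoint of \<open>1 + V\<close> on
        \<open>S\<close>, so testing \<open>y\<close> against \<open>(1 + V) ?u\<close> gives the
        squared norm of \<open>?u\<close>. Hence \<open>V' y = - y\<close> and
        \<open>V y = - y\<close>, which puts \<open>y\<close> into \<open>N\<close>.\<close>
      let ?u = "y + V' y"
      have u: "?u \<in> S" using y by (intro SI VD')
      have "?u \<bullet> ?u = y \<bullet> (?u + V ?u)"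
        using V_adj[OF u y] by (simp add: inner_add_left inner_add_right inner_commute)
      also have "\<dots> = 0" using orth[of "(?u, 0)"] u N0 by (simp add: w_def J_zero)
      finally have *: "?u = 0" by simp
      then have "V ?u = 0" by (simp only: V.zero)
      then have "V y + y = 0" using y by (simp add: V.add inv)
      then have "P (P y) = 0" using * y by (simp add: PP scaleR_2 algebra_simps)
      then have "- J y \<in> N" using in_N[OF y] NJ by (auto simp: N_def P.neg intro: subspace_neg[OF SS(1)])
      \<comment> \<open>The choice \<open>- J y\<close> is made because \<open>J\<close> sends it to
        \<open>y\<close>.\<close>
      then show "y = 0" using orth[of "(0, - J y)"] y by (simp add: w_def SI V.zero J_neg J_J)
    qed
    show "v p \<bullet> J (v q) = w p \<bullet> J (w q)" if "p \<in> S \<times> N" "q \<in> S \<times> N" for p q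
      using that by (simp add: Jv Jw gram dK)
  qed (rule gram)
  then obtain W where W: "unitary_on S W" and Wv: "\<And>x z. x \<in> S \<Longrightarrow> z \<in> N \<Longrightarrow> W (P x + z) = x + V x + J z"
    by (auto simp: v_def w_def)
  have "W (W x) = V x" if "x \<in> S" for x
  \<comment> \<open>\<open>P (P x)\<close> is used instead of \<open>P x\<close> because
    \<open>W\<close> sends it to \<open>P (x + V x)\<close>, which is again in the range of
    \<open>P\<close>, so that the formula for \<open>W\<close> applies a second time.\<close>
  proof (rule bounded_linear_eq_on_total[OF SS, where A = "{P (P x) + z | x z. x \<in> S \<and> z \<in> N}"
        and f = "\<lambda>x. W (W x)" and g = V])
    show "bounded_linear (\<lambda>x. W (W x))"
      using bounded_linear_compose unitary_onD(1)[OF W] by blast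
    show "{P (P x) + z | x z. x \<in> S \<and> z \<in> N} \<subseteq> S" by (auto intro!: SI(1) PS intro: N(1))
    show "y = 0" if y: "y \<in> S" "y \<in> orth_compl {P (P x) + z | x z. x \<in> S \<and> z \<in> N}" for y
    proof -
      have orth: "y \<bullet> (P (P a) + z) = 0" if "a \<in> S" "z \<in> N" for a z
        using y(2) that by (force simp: orth_compl_iff)
      have "P y \<bullet> P y = 0" using orth[OF y(1) N0] y(1) by (simp add: P_sym PS)
      then have "y \<in> N" using y(1) by (simp add: N_def)
      from orth[OF subspace_0[OF SS(1)] this] show "y = 0" by (simp add: P.zero)
    qed
    fix t assume "t \<in> {P (P x) + z | x z. x \<in> S \<and> z \<in> N}"
    then obtain a z where a: "a \<in> S" and z: "z \<in> N" and t: "t = P (P a) + z" by blast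
    have "W t = P (a + V a) + J z"
      unfolding t by (simp add: Wv PS a z PV P.add)
    also have "W \<dots> = (a + V a) + V (a + V a) + J (J z)"
      using a z by (intro Wv NJ) (auto intro!: SI VD)
    also have "\<dots> = V t"
      using a by (simp add: t PP V.add V.scaleR inv NV(1)[OF z] J_J scaleR_2)
    finally show "W (W t) = V t" .
  qed (use that VD(1) in auto)
  with W show ?thesis by blast
qed

text \<open>The new operator is the direct sum of \<open>R\<close> on \<open>S\<close> and a root of
  \<open>V\<close> on the complement \<open>M\<close>. That \<open>V\<close> maps \<open>M\<close>
  onto itself follows since on \<open>S\<close> it agrees with \<open>R\<close> squared, a bijection
  of \<open>S\<close>.\<close>

lemma unitary_sqrt_extension:
  assumes S: "closed_csubspace S" and S': "closed_csubspace S'" and sub: "S \<subseteq> S'"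
    and R: "unitary_on S R" and V: "unitary_on S' V" and VR: "\<And>x. x \<in> S \<Longrightarrow> V x = R (R x)"
  shows "\<exists>R'. unitary_on S' R' \<and> (\<forall>x\<in>S. R' x = R x) \<and> (\<forall>x\<in>S'. R' (R' x) = V x)"
proof -
  note SS = closed_csubspaceD(1,2)[OF S] and SS' = closed_csubspaceD(1,2)[OF S']
  note RD = unitary_onD[OF R] and VD = unitary_onD[OF V]
  define M where "M = S' \<inter> orth_compl S"
  have M: "closed_csubspace M"
    unfolding closed_csubspace_def M_def
  proof (intro conjI ballI)
    show "subspace (S' \<inter> orth_compl S)" by (intro subspace_inter SS' subspace_orth_compl)
    show "closed (S' \<inter> orth_compl S)" by (intro closed_Int SS' closed_orth_compl)
    show "J x \<in> S' \<inter> orth_compl S" if "x \<in> S' \<inter> orth_compl S" for x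
      using that closed_csubspaceD(3)[OF S'] closed_csubspaceD(3)[OF S] by (auto simp: orth_compl_iff inner_J_left)
  qed
  have "unitary_on M V"
    unfolding unitary_on_def
  proof (intro conjI ballI)
    fix x assume "x \<in> M"
    then have x: "x \<in> S'" "\<And>s. s \<in> S \<Longrightarrow> x \<bullet> s = 0" by (auto simp: M_def orth_compl_iff)
    show "norm (V x) = norm x" "V (J x) = J (V x)" using x VD by auto
    have "V x \<bullet> s = 0" if s: "s \<in> S" for s
    proof -
      obtain s1 where s1: "s1 \<in> S" "R s1 = s" using RD(5)[OF s] by blast
      obtain s2 where s2: "s2 \<in> S" "R s2 = s1" using RD(5)[OF s1(1)] by blast
      have "V x \<bullet> V s2 = x \<bullet> s2"
        using x s2 sub by (intro unitary_on_inner[OF S' V]) auto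
      with x(2)[OF s2(1)] VR[OF s2(1)] s1 s2 show ?thesis by simp
    qed
    then show "V x \<in> M" using VD(2)[OF x(1)] by (auto simp: M_def orth_compl_iff)
  next
    fix y assume "y \<in> M"
    then have y: "y \<in> S'" "\<And>s. s \<in> S \<Longrightarrow> y \<bullet> s = 0" by (auto simp: M_def orth_compl_iff)
    obtain x where x: "x \<in> S'" "V x = y" using VD(5)[OF y(1)] by blast
    have "x \<bullet> s = 0" if s: "s \<in> S" for s
      using unitary_on_inner[OF S' V x(1), of s] y(2)[OF RD(2)[OF RD(2)[OF s]]] s sub VR[OF s] x(2)
      by auto
    with x show "\<exists>x\<in>M. V x = y" by (auto simp: M_def orth_compl_iff)
  qed (rule VD(1))
  then obtain W where W: "unitary_on M W" and WW: "\<And>x. x \<in> M \<Longrightarrow> W (W x) = V x"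
    using unitary_sqrt[OF M] by blast
  note WD = unitary_onD[OF W]
  interpret R: bounded_linear R by (rule RD(1))
  interpret W: bounded_linear W by (rule WD(1))
  interpret V: bounded_linear V by (rule VD(1))
  interpret p: bounded_linear "orth_proj S" by (rule bounded_linear_orth_proj[OF SS])
  have pS: "orth_proj S x \<in> S" for x by (rule orth_proj_in[OF SS])
  have qM: "x - orth_proj S x \<in> M" if "x \<in> S'" for x
    using that pS sub orth_proj_orth[OF SS] unfolding M_def by (blast intro: subspace_diff[OF SS'(1)])
  define R' where "R' x = R (orth_proj S x) + W (x - orth_proj S x)" for x
  have R'_bl: "bounded_linear R'"
    unfolding R'_def
    by (intro bounded_linear_add bounded_linear_sub bounded_linear_ident p.bounded_linear_axioms
        bounded_linear_compose[OF RD(1)] bounded_linear_compose[OF WD(1)])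
  have orth: "norm (a + b) = sqrt ((norm a)\<^sup>2 + (norm b)\<^sup>2)" if "a \<in> S" "b \<in> M" for a b
    using that by (intro real_sqrt_unique[symmetric] norm_add_Pythagorean)
      (auto simp: M_def orth_compl_iff orthogonal_def inner_commute)
  have R'_in: "R' x \<in> S'" if "x \<in> S'" for x
    using RD(2)[OF pS] WD(2)[OF qM[OF that]] sub
    by (auto simp: R'_def M_def intro!: subspace_add[OF SS'(1)])
  have R'_norm: "norm (R' x) = norm x" if "x \<in> S'" for x
    unfolding R'_def orth[OF RD(2)[OF pS] WD(2)[OF qM[OF that]]]
      RD(3)[OF pS] WD(3)[OF qM[OF that]] orth[OF pS qM[OF that], symmetric] by simp
  have proj_J: "orth_proj S (J x) = J (orth_proj S x)" for x
    using pS closed_csubspaceD(3)[OF S] orth_proj_orth[OF SS, of x]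
    by (intro orth_proj_unique[OF SS]) (auto simp: orth_compl_iff J_diff[symmetric] inner_J_left)
  have R'_J: "R' (J x) = J (R' x)" if "x \<in> S'" for x
    using RD(4)[OF pS] WD(4)[OF qM[OF that]]
    by (simp add: R'_def proj_J J_add J_diff[symmetric])
  have R'_R': "R' (R' x) = V x" if "x \<in> S'" for x
  proof -
    have "orth_proj S (R' x) = R (orth_proj S x)"
      using RD(2)[OF pS] WD(2)[OF qM[OF that]] by (intro orth_proj_unique[OF SS]) (auto simp: R'_def M_def)
    then have "R' (R' x) = R (R (orth_proj S x)) + W (W (x - orth_proj S x))"
      unfolding R'_def[of "R' x"] by (simp add: R'_def[of x])
    then show ?thesis
      by (simp add: WW[OF qM[OF that]] VR[OF pS, symmetric] V.diff)
  qed
  have "\<exists>x\<in>S'. R' x = y" if "y \<in> S'" for y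
    using VD(5)[OF that] R'_R' R'_in by metis
  then have "unitary_on S' R'"
    unfolding unitary_on_def using R'_bl R'_in R'_norm R'_J by blast
  moreover have "R' x = R x" if "x \<in> S" for x
    by (simp add: R'_def orth_proj_id[OF SS that] W.zero)
  ultimately show ?thesis using R'_R' by blast
qed

section \<open>Closed complex spans\<close>

definition cspan_closure :: "'a set \<Rightarrow> 'a set" where
  "cspan_closure A = closure (span (A \<union> J ` A))"

lemma closed_csubspace_cspan_closure: "closed_csubspace (cspan_closure A)"
  unfolding closed_csubspace_def
proof (intro conjI ballI)
  show sub: "subspace (cspan_closure A)" and cl: "closed (cspan_closure A)"
    by (simp_all add: cspan_closure_def subspace_closure)
  have base: "A \<union> J ` A \<subseteq> cspan_closure A"
    unfolding cspan_closure_def using span_superset closure_subset by (rule order_trans)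
  have "cspan_closure A \<subseteq> J -` cspan_closure A"
    unfolding cspan_closure_def[of A]
  proof (intro closure_minimal span_minimal)
    show "A \<union> J ` A \<subseteq> J -` closure (span (A \<union> J ` A))"
      using base subspace_neg[OF sub] by (auto simp: J_J cspan_closure_def)
    show "subspace (J -` closure (span (A \<union> J ` A)))"
      using sub by (intro linear_subspace_vimage bounded_linear.linear[OF bounded_linear_J])
        (simp add: cspan_closure_def)
    show "closed (J -` closure (span (A \<union> J ` A)))"
      by (intro continuous_closed_vimage linear_continuous_at bounded_linear_J) simp
  qed
  then show "J x \<in> cspan_closure A" if "x \<in> cspan_closure A" for x using that by blast
qed

lemma cspan_closure_base: "x \<in> A \<Longrightarrow> x \<in> cspan_closure A" "x \<in> A \<Longrightarrow> J x \<in> cspan_closure A"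
  unfolding cspan_closure_def by (rule subsetD[OF closure_subset], rule span_base, simp)+

lemma cspan_closure_induct:
  assumes "x \<in> cspan_closure A" "bounded_linear f" "subspace M" "closed M"
    and "\<And>a. a \<in> A \<Longrightarrow> f a \<in> M" "\<And>a. a \<in> A \<Longrightarrow> f (J a) \<in> M"
  shows "f x \<in> M"
proof -
  have "cspan_closure A \<subseteq> f -` M"
    unfolding cspan_closure_def
    by (intro closure_minimal span_minimal linear_subspace_vimage continuous_closed_vimage
        linear_continuous_at bounded_linear.linear[OF assms(2)] assms(2-4)) (use assms in auto)
  with assms(1) show ?thesis by blast
qed

lemma cspan_closure_mono: "A \<subseteq> B \<Longrightarrow> cspan_closure A \<subseteq> cspan_closure B"
  unfolding cspan_closure_def by (intro closure_mono span_mono) blast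

lemma cspan_closure_total:
  assumes "y \<in> cspan_closure A" "\<And>a. a \<in> A \<Longrightarrow> y \<bullet> a = 0 \<and> y \<bullet> J a = 0"
  shows "y = 0"
proof -
  have "y \<in> orth_compl (cspan_closure A)"
    unfolding cspan_closure_def orth_compl_closure_span using assms(2) by (auto simp: orth_compl_iff)
  with assms(1) have "y \<bullet> y = 0" by (auto simp: orth_compl_iff)
  then show ?thesis by simp
qed

lemma cspan_closure_eqI:
  fixes f g :: "'a \<Rightarrow> 'a"
  assumes "x \<in> cspan_closure A" "bounded_linear f" "bounded_linear g"
    and "\<And>a. a \<in> A \<Longrightarrow> f a = g a" "\<And>a. a \<in> A \<Longrightarrow> f (J a) = g (J a)"
  shows "f x = g x"
  using cspan_closure_induct[of x A "\<lambda>x. f x - g x" "{0}"] assms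
  by (simp add: bounded_linear_sub)

section \<open>Level by level construction of the two unitaries\<close>

lemma unitary_on_conj:
  assumes W: "closed_csubspace S" "closed_csubspace S'" "S \<subseteq> H" "S' \<subseteq> H"
    and U: "unitary_on H U" and U': "unitary_on H U'" and R: "unitary_on S R"
    and inv: "\<And>x. x \<in> H \<Longrightarrow> U (U' x) = x" "\<And>x. x \<in> H \<Longrightarrow> U' (U x) = x"
    and into: "\<And>x. x \<in> S \<Longrightarrow> U x \<in> S'" "\<And>x. x \<in> S' \<Longrightarrow> U' x \<in> S"
  shows "unitary_on S' (\<lambda>x. U (R (U' x)))"
  unfolding unitary_on_def
proof (intro conjI ballI)
  note UD = unitary_onD[OF U] and UD' = unitary_onD[OF U'] and RD = unitary_onD[OF R]
  show "bounded_linear (\<lambda>x. U (R (U' x)))"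
    by (intro bounded_linear_compose[OF UD(1)] bounded_linear_compose[OF RD(1)] UD'(1))
  fix x assume x: "x \<in> S'"
  then have m: "x \<in> H" "U' x \<in> S" "R (U' x) \<in> S" "U' x \<in> H" "R (U' x) \<in> H"
    using into RD W by blast+
  show "U (R (U' x)) \<in> S'" using into(1) m by blast
  show "norm (U (R (U' x))) = norm x" using m by (simp add: UD RD UD')
  show "U (R (U' (J x))) = J (U (R (U' x)))" using m by (simp add: UD RD UD')
  obtain z where z: "z \<in> S" "R z = U' x" using RD(5)[OF m(2)] by blast
  then have "U z \<in> S'" "U (R (U' (U z))) = x" using into(1) inv m(1) W(3) by auto
  then show "\<exists>z\<in>S'. U (R (U' z)) = x" by blast
qed

text \<open>The two forms of each invariance are the real and imaginary parts of one complex
  identity. For \<open>T\<close> only the values on \<open>e 0 k\<close> are recorded, because the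
  powers of \<open>U\<close> carry these to all other \<open>e j k\<close>.\<close>

theorem baumslag_solitar_representation:
  fixes e :: "int \<Rightarrow> int \<Rightarrow> 'a"
  assumes shift1: "\<And>j k j' k'. e (j + 1) k \<bullet> e (j' + 1) k' = e j k \<bullet> e j' k'"
      "\<And>j k j' k'. e (j + 1) k \<bullet> J (e (j' + 1) k') = e j k \<bullet> J (e j' k')"
    and shift2: "\<And>j k j' k'. j \<le> 0 \<Longrightarrow> j' \<le> 0 \<Longrightarrow>
        e j (2 ^ nat (- j) + k) \<bullet> e j' (2 ^ nat (- j') + k') = e j k \<bullet> e j' k'"
      "\<And>j k j' k'. j \<le> 0 \<Longrightarrow> j' \<le> 0 \<Longrightarrow>
        e j (2 ^ nat (- j) + k) \<bullet> J (e j' (2 ^ nat (- j') + k')) = e j k \<bullet> J (e j' k')"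
  defines "H \<equiv> cspan_closure (range (case_prod e))"
  shows "\<exists>U T. unitary_on H U \<and> unitary_on H T \<and> (\<forall>j k. U (e j k) = e (j + 1) k) \<and>
    (\<forall>k. T (e 0 k) = e 0 (k + 1)) \<and> (\<forall>x\<in>H. U (T x) = T (T (U x)))"
proof -
  define E where "E n = {e j k | j k. j \<le> n}" for n
  define Hs where "Hs n = cspan_closure (E n)" for n
  have H: "closed_csubspace H" and Hs: "closed_csubspace (Hs n)" for n
    by (simp_all add: H_def Hs_def closed_csubspace_cspan_closure)
  have eH: "e j k \<in> H" for j k
    unfolding H_def by (rule cspan_closure_base) (auto intro: rev_image_eqI[of "(j, k)"])
  have eHs: "e j k \<in> Hs n" if "j \<le> n" for j k n
    unfolding Hs_def by (rule cspan_closure_base) (use that in \<open>auto simp: E_def\<close>)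
  have HsH: "Hs n \<subseteq> H" for n
    unfolding Hs_def H_def by (rule cspan_closure_mono) (auto simp: E_def)
  have Hs_mono: "Hs m \<subseteq> Hs n" if "m \<le> n" for m n
    unfolding Hs_def by (rule cspan_closure_mono) (use that in \<open>auto simp: E_def intro: order_trans\<close>)
  have H_tot: "y = 0" if "y \<in> H" "\<And>j k. y \<bullet> e j k = 0 \<and> y \<bullet> J (e j k) = 0" for y
    by (rule cspan_closure_total[OF that(1)[unfolded H_def]]) (use that(2) in auto)
  have "\<exists>U. unitary_on H U \<and> (\<forall>p\<in>UNIV. U (e (fst p) (snd p)) = e (fst p + 1) (snd p))"
  proof (rule unitary_extension[OF H])
    fix y assume y: "y \<in> H" and *: "\<And>i. i \<in> UNIV \<Longrightarrow> y \<bullet> e (fst i + 1) (snd i) = 0 \<and> y \<bullet> J (e (fst i + 1) (snd i)) = 0"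
    show "y = 0" using *[of "(j - 1, k)" for j k] by (intro H_tot[OF y]) simp
  next
    fix y assume y: "y \<in> H" and *: "\<And>i. i \<in> UNIV \<Longrightarrow> y \<bullet> e (fst i) (snd i) = 0 \<and> y \<bullet> J (e (fst i) (snd i)) = 0"
    show "y = 0" using *[of "(_, _)"] by (intro H_tot[OF y]) simp
  qed (simp_all add: eH shift1)
  then obtain U where U: "unitary_on H U" and Ue: "\<And>j k. U (e j k) = e (j + 1) k" by auto
  obtain U' where U': "unitary_on H U'" and inv: "\<And>x. x \<in> H \<Longrightarrow> U' (U x) = x" "\<And>x. x \<in> H \<Longrightarrow> U (U' x) = x"
    using unitary_inverse[OF H U] by blast
  note UD = unitary_onD[OF U] and UD' = unitary_onD[OF U']
  have U'e: "U' (e j k) = e (j - 1) k" for j k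
    using inv(1)[OF eH, of "j - 1" k] by (simp add: Ue)
  have U_Hs: "U x \<in> Hs (n + 1)" if "x \<in> Hs n" for x n
    using that unfolding Hs_def[of n]
    by (rule cspan_closure_induct[OF _ UD(1) closed_csubspaceD(1,2)[OF Hs]])
      (auto simp: E_def Ue UD(4)[OF eH] intro!: eHs closed_csubspaceD(3)[OF Hs])
  have U'_Hs: "U' x \<in> Hs n" if "x \<in> Hs (n + 1)" for x n
    using that unfolding Hs_def[of "n + 1"]
    by (rule cspan_closure_induct[OF _ UD'(1) closed_csubspaceD(1,2)[OF Hs]])
      (auto simp: E_def U'e UD'(4)[OF eH] intro!: eHs closed_csubspaceD(3)[OF Hs])
  \<comment> \<open>The shift \<open>2^(-j)\<close> at level \<open>j \<le> 0\<close>. For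
    \<open>j > 0\<close> the truncation by \<open>nat\<close> gives the value 1 instead.\<close>
  define s where "s j = (2::int) ^ nat (- j)" for j :: int
  have s_step: "s j = 2 * s (j + 1)" if "j \<le> -1" for j
  proof -
    have "nat (- j) = Suc (nat (- (j + 1)))" using that by simp
    then show ?thesis by (simp add: s_def)
  qed
  have "\<exists>R. unitary_on (Hs 0) R \<and> (\<forall>p\<in>{..0} \<times> UNIV. R (e (fst p) (snd p)) = e (fst p) (s (fst p) + snd p))"
  proof (rule unitary_extension[OF Hs])
    have Hs_tot: "y = 0" if "y \<in> Hs 0" "\<And>j k. j \<le> 0 \<Longrightarrow> y \<bullet> e j k = 0 \<and> y \<bullet> J (e j k) = 0" for y
      by (rule cspan_closure_total[OF that(1)[unfolded Hs_def]]) (use that(2) in \<open>auto simp: E_def\<close>)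
    fix y assume y: "y \<in> Hs 0"
    show "y = 0" if *: "\<And>i. i \<in> {..0} \<times> UNIV \<Longrightarrow> y \<bullet> e (fst i) (snd i) = 0 \<and> y \<bullet> J (e (fst i) (snd i)) = 0"
      using *[of "(_, _)"] by (intro Hs_tot[OF y]) simp
    show "y = 0" if *: "\<And>i. i \<in> {..0} \<times> UNIV \<Longrightarrow> y \<bullet> e (fst i) (s (fst i) + snd i) = 0 \<and> y \<bullet> J (e (fst i) (s (fst i) + snd i)) = 0"
    proof (rule Hs_tot[OF y])
      show "y \<bullet> e j k = 0 \<and> y \<bullet> J (e j k) = 0" if "j \<le> 0" for j k
        \<comment> \<open>Adding \<open>s j\<close> permutes the integers, so the shifted family at
          level \<open>j\<close> is the whole family at that level.\<close>
        using *[of "(j, k - s j)"] that by simp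
    qed
  qed (auto simp: s_def shift2 intro!: eHs)
  then obtain R0 where R0: "unitary_on (Hs 0) R0" and R0e: "\<And>j k. j \<le> 0 \<Longrightarrow> R0 (e j k) = e j (s j + k)"
    by force
  \<comment> \<open>The relation is demanded one level lower than \<open>R\<close> acts, since it
    applies \<open>R\<close> to \<open>U x\<close> and \<open>U\<close> raises the level by
    one.\<close>
  define compat where "compat n R \<longleftrightarrow> unitary_on (Hs (int n)) R \<and>
      (\<forall>x\<in>Hs (int n - 1). U (R x) = R (R (U x)))" for n R
  have "\<exists>R. \<forall>n. (compat n (R n) \<and> (n = 0 \<longrightarrow> R n = R0)) \<and> (\<forall>x\<in>Hs (int n). R (Suc n) x = R n x)"
  \<comment> \<open>The clause for \<open>n = 0\<close> pins the start of the sequence to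
    \<open>R0\<close>, whose values on \<open>e 0 k\<close> are the prescribed ones.\<close>
  proof (rule dependent_nat_choice[where P = "\<lambda>n R. compat n R \<and> (n = 0 \<longrightarrow> R = R0)"
        and Q = "\<lambda>n R R'. \<forall>x\<in>Hs (int n). R' x = R x"])
    have "U (R0 x) = R0 (R0 (U x))" if "x \<in> Hs (-1)" for x
    proof (rule cspan_closure_eqI[OF that[unfolded Hs_def], of "\<lambda>x. U (R0 x)" "\<lambda>x. R0 (R0 (U x))"])
      note RD = unitary_onD[OF R0]
      show "bounded_linear (\<lambda>x. U (R0 x))" "bounded_linear (\<lambda>x. R0 (R0 (U x)))"
        by (intro bounded_linear_compose[OF UD(1)] bounded_linear_compose[OF RD(1)] UD(1) RD(1))+
      fix a assume "a \<in> E (-1)"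
      then obtain j k where a: "a = e j k" "j \<le> -1" by (auto simp: E_def)
      have "R0 a \<in> H" "U a \<in> Hs 0" "R0 (U a) \<in> Hs 0" "a \<in> Hs 0" "a \<in> H"
        using a by (auto simp: R0e Ue eH intro!: eHs)
      then have *: "U (R0 (J a)) = J (U (R0 a))" "R0 (R0 (U (J a))) = J (R0 (R0 (U a)))"
        by (simp_all add: UD(4) RD(4))
      show eq: "U (R0 a) = R0 (R0 (U a))"
        \<comment> \<open>Both sides move \<open>e j k\<close> to level \<open>j + 1\<close>, one
          with shift \<open>s j\<close>, the other with two shifts \<open>s (j + 1)\<close>; these
          agree because \<open>j + 1 \<le> 0\<close>.\<close>
        using a by (simp add: R0e Ue s_step algebra_simps)
      show "U (R0 (J a)) = R0 (R0 (U (J a)))" unfolding * eq ..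
    qed
    then show "\<exists>R. compat 0 R \<and> ((0::nat) = 0 \<longrightarrow> R = R0)"
      using R0 by (auto simp: compat_def)
  next
    fix R n assume "compat n R \<and> (n = 0 \<longrightarrow> R = R0)"
    then have R: "unitary_on (Hs (int n)) R" and c: "\<And>x. x \<in> Hs (int n - 1) \<Longrightarrow> U (R x) = R (R (U x))"
      by (auto simp: compat_def)
    let ?S = "Hs (int n)" and ?S' = "Hs (int n + 1)"
    have sub: "?S \<subseteq> ?S'" by (rule Hs_mono) simp
    have V: "unitary_on ?S' (\<lambda>x. U (R (U' x)))"
      by (rule unitary_on_conj[OF Hs Hs HsH HsH U U' R]) (auto intro: inv U_Hs U'_Hs)
    \<comment> \<open>For \<open>x\<close> on level \<open>n\<close> the vector \<open>U' x\<close>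
      is on level \<open>n - 1\<close>, where the relation is already available.\<close>
    have VR: "U (R (U' x)) = R (R x)" if "x \<in> ?S" for x
      using c[OF U'_Hs[of x "int n - 1"]] that HsH[of "int n"] inv(2) by auto
    obtain R' where R': "unitary_on ?S' R'" "\<And>x. x \<in> ?S \<Longrightarrow> R' x = R x"
      "\<And>x. x \<in> ?S' \<Longrightarrow> R' (R' x) = U (R (U' x))"
      using unitary_sqrt_extension[OF Hs Hs sub R V VR] by blast
    have "U (R' x) = R' (R' (U x))" if x: "x \<in> ?S" for x
      using R'(2)[OF x] R'(3)[OF U_Hs[OF x]] inv(1)[OF subsetD[OF HsH x]] by simp
    with R' show "\<exists>R'. (compat (Suc n) R' \<and> (Suc n = 0 \<longrightarrow> R' = R0)) \<and> (\<forall>x\<in>?S. R' x = R x)"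
      by (auto simp: compat_def algebra_simps)
  qed
  then obtain R where R: "\<And>n. compat n (R n)" "R 0 = R0"
    and RSuc: "\<And>n x. x \<in> Hs (int n) \<Longrightarrow> R (Suc n) x = R n x"
    by blast
  have Ru: "unitary_on (Hs (int n)) (R n)" for n using R(1) by (auto simp: compat_def)
  note RD = unitary_onD[OF Ru]
  have R_eq: "R m x = R n x" if "n \<le> m" "x \<in> Hs (int n)" for m n x
    using that(1)
  proof (induction m rule: dec_induct)
    case (step m)
    have "x \<in> Hs (int m)" using that(2) Hs_mono[of "int n" "int m"] step by auto
    with step show ?case by (simp add: RSuc)
  qed simp
  define G where "G = (\<Union>n. Hs (int n))"
  \<comment> \<open>Any stage containing \<open>x\<close> gives the same value; the least one is
    just a canonical choice.\<close>
  define w where "w x = R (LEAST n. x \<in> Hs (int n)) x" for x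
  have w: "w x = R n x" if "x \<in> Hs (int n)" for x n
    unfolding w_def using that
    by (intro R_eq[symmetric]) (auto intro: Least_le LeastI)
  have in_Hs_max: "x \<in> Hs (int (max m n))" "x \<in> Hs (int (max n m))" if "x \<in> Hs (int m)" for x m n
    using that Hs_mono[of "int m" "int (max m n)"] Hs_mono[of "int m" "int (max n m)"] by auto
  have eG: "\<exists>n. e j k \<in> Hs (int n)" for j k
    by (rule exI[of _ "nat j"]) (auto intro: eHs)
  have "\<exists>T. unitary_on H T \<and> (\<forall>x\<in>G. T x = w x)"
  proof (rule unitary_extension[OF H])
    show "x \<in> H" if "x \<in> G" for x using that HsH by (auto simp: G_def)
    show "w x \<in> H" if "x \<in> G" for x
      using that HsH RD(2) by (fastforce simp: G_def w)
    show "y = 0" if "y \<in> H" "\<And>x. x \<in> G \<Longrightarrow> y \<bullet> x = 0 \<and> y \<bullet> J x = 0" for y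
      using that(2) eG by (intro H_tot[OF that(1)]) (auto simp: G_def)
    \<comment> \<open>Each stage is onto its level, so every \<open>e j k\<close> is itself a value
      of \<open>w\<close>.\<close>
    show "y = 0" if y: "y \<in> H" "\<And>x. x \<in> G \<Longrightarrow> y \<bullet> w x = 0 \<and> y \<bullet> J (w x) = 0" for y
    proof (rule H_tot[OF y(1)])
      fix j k
      obtain n where "e j k \<in> Hs (int n)" using eG by blast
      then obtain x where x: "x \<in> Hs (int n)" "R n x = e j k" using RD(5) by blast
      then show "y \<bullet> e j k = 0 \<and> y \<bullet> J (e j k) = 0"
        using y(2)[of x] w[OF x(1)] by (auto simp: G_def)
    qed
    fix x y assume "x \<in> G" "y \<in> G"
    then obtain m n where "x \<in> Hs (int m)" "y \<in> Hs (int n)" by (auto simp: G_def)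
    then have *: "x \<in> Hs (int (max m n))" "y \<in> Hs (int (max m n))" by (auto intro: in_Hs_max)
    show "x \<bullet> y = w x \<bullet> w y"
      using * by (simp only: w unitary_on_inner[OF Hs Ru])
    show "x \<bullet> J y = w x \<bullet> J (w y)"
      using * closed_csubspaceD(3)[OF Hs] by (simp only: w RD(4)[symmetric] unitary_on_inner[OF Hs Ru])
  qed
  then obtain T where T: "unitary_on H T" and TG: "\<And>x. x \<in> G \<Longrightarrow> T x = w x" by blast
  note TD = unitary_onD[OF T]
  have TR: "T x = R n x" if "x \<in> Hs (int n)" for x n
    using TG[of x] w[OF that] that by (auto simp: G_def)
  have UT: "U (T x) = T (T (U x))" if x: "x \<in> Hs (int n)" for x n
  proof -
    have Ux: "U x \<in> Hs (int (Suc n))" using U_Hs[OF x] by (simp add: add.commute)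
    have "U (R (Suc n) x) = R (Suc n) (R (Suc n) (U x))"
      using R(1)[of "Suc n"] x by (simp add: compat_def)
    then show ?thesis
      by (simp only: TR[OF Ux] TR[OF RD(2)[OF Ux]] TR[OF x] RSuc[OF x])
  qed
  have "U (T x) = T (T (U x))" if "x \<in> H" for x
  proof (rule cspan_closure_eqI[OF that[unfolded H_def], of "\<lambda>x. U (T x)" "\<lambda>x. T (T (U x))"])
    show "bounded_linear (\<lambda>x. U (T x))" "bounded_linear (\<lambda>x. T (T (U x)))"
      by (intro bounded_linear_compose[OF UD(1)] bounded_linear_compose[OF TD(1)] UD(1) TD(1))+
    fix a assume "a \<in> range (case_prod e)"
    then obtain j k where "a = e j k" by auto
    with eG obtain n where "a \<in> Hs (int n)" by blast
    then show "U (T a) = T (T (U a))" "U (T (J a)) = T (T (U (J a)))"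
      using UT closed_csubspaceD(3)[OF Hs] by blast+
  qed
  moreover have "T (e 0 k) = e 0 (k + 1)" for k
    using TR[of "e 0 k" 0] eHs[of 0 0 k] by (simp add: R(2) R0e s_def add.commute)
  ultimately show ?thesis using U T Ue by blast
qed

end

section \<open>Gram vectors\<close>

lemma summable_prod_of_squares:
  fixes f g :: "nat \<Rightarrow> 'a::real_inner"
  assumes "summable (\<lambda>n. (norm (f n))\<^sup>2)" "summable (\<lambda>n. (norm (g n))\<^sup>2)"
  shows "summable (\<lambda>n. f n \<bullet> g n)"
proof (rule summable_comparison_test'[where N = 0])
  show "summable (\<lambda>n. (norm (f n))\<^sup>2 + (norm (g n))\<^sup>2)" by (intro summable_add assms)
  fix n
  have "\<bar>f n \<bullet> g n\<bar> \<le> norm (f n) * norm (g n)" by (rule Cauchy_Schwarz_ineq2)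
  also have "\<dots> \<le> (norm (f n))\<^sup>2 + (norm (g n))\<^sup>2"
    using sum_squares_bound[of "norm (f n)" "norm (g n)"]
      mult_nonneg_nonneg[OF norm_ge_zero[of "f n"] norm_ge_zero[of "g n"]] by linarith
  finally show "norm (f n \<bullet> g n) \<le> (norm (f n))\<^sup>2 + (norm (g n))\<^sup>2" by simp
qed

lemma summable_norm_add_square:
  fixes f g :: "nat \<Rightarrow> 'a::real_inner"
  assumes "summable (\<lambda>n. (norm (f n))\<^sup>2)" "summable (\<lambda>n. (norm (g n))\<^sup>2)"
  shows "summable (\<lambda>n. (norm (f n + g n))\<^sup>2)"
proof -
  have "(\<lambda>n. (norm (f n + g n))\<^sup>2) = (\<lambda>n. (norm (f n))\<^sup>2 + 2 * (f n \<bullet> g n) + (norm (g n))\<^sup>2)"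
    by (simp add: power2_norm_eq_inner inner_add_left inner_add_right inner_commute fun_eq_iff)
  then show ?thesis
    by (simp only:) (intro summable_add summable_mult summable_prod_of_squares assms)
qed

section \<open>The real Hilbert space of square summable complex sequences\<close>

typedef ell2 = "{f :: nat \<Rightarrow> complex. summable (\<lambda>n. (norm (f n))\<^sup>2)}"
  morphisms coord Ell2
  by (rule exI[of _ "\<lambda>n. 0"]) simp

lemma summable_coord: "summable (\<lambda>n. (norm (coord x n))\<^sup>2)"
  using coord[of x] by simp

lemma coord_Ell2: "summable (\<lambda>n. (norm (f n))\<^sup>2) \<Longrightarrow> coord (Ell2 f) = f"
  by (simp add: Ell2_inverse)

lemma ell2_eqI: "(\<And>n. coord x n = coord y n) \<Longrightarrow> x = y"
  by (metis coord_inject ext)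

instantiation ell2 :: real_inner
begin

definition zero_ell2_def: "0 = Ell2 (\<lambda>n. 0)"
definition plus_ell2_def: "x + y = Ell2 (\<lambda>n. coord x n + coord y n)"
definition uminus_ell2_def: "- x = Ell2 (\<lambda>n. - coord x n)"
definition minus_ell2_def: "x - y = Ell2 (\<lambda>n. coord x n - coord y n)"
definition scaleR_ell2_def: "r *\<^sub>R x = Ell2 (\<lambda>n. r *\<^sub>R coord x n)"
definition inner_ell2_def: "x \<bullet> y = (\<Sum>n. coord x n \<bullet> coord y n)"
definition norm_ell2_def: "norm x = sqrt (x \<bullet> x)" for x :: ell2
definition sgn_ell2_def: "sgn x = inverse (norm x) *\<^sub>R x" for x :: ell2
definition dist_ell2_def: "dist x y = norm (x - y)" for x y :: ell2
definition uniformity_ell2_def: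
  "uniformity = (INF e\<in>{0<..}. principal {(x :: ell2, y). dist x y < e})"
definition open_ell2_def:
  "open U \<longleftrightarrow> (\<forall>x\<in>U. eventually (\<lambda>(x', y). x' = x \<longrightarrow> y \<in> U) uniformity)" for U :: "ell2 set"

lemma coord_zero: "coord 0 n = 0"
  by (simp add: zero_ell2_def coord_Ell2)
lemma coord_plus: "coord (x + y) n = coord x n + coord y n"
  by (simp add: plus_ell2_def coord_Ell2 summable_norm_add_square summable_coord)
lemma coord_uminus: "coord (- x) n = - coord x n"
  by (simp add: uminus_ell2_def coord_Ell2 summable_coord)
lemma coord_minus: "coord (x - y) n = coord x n - coord y n"
  using summable_norm_add_square[of "coord x" "\<lambda>n. - coord y n"]
  by (simp add: minus_ell2_def coord_Ell2 summable_coord)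
lemma coord_scaleR: "coord (r *\<^sub>R x) n = r *\<^sub>R coord x n"
  by (simp add: scaleR_ell2_def coord_Ell2 summable_coord power_mult_distrib summable_mult)

lemmas coord_simps = coord_zero coord_plus coord_uminus coord_minus coord_scaleR

lemma summable_coord_inner: "summable (\<lambda>n. coord x n \<bullet> coord y n)"
  by (intro summable_prod_of_squares summable_coord)

instance
proof
  fix x y z :: ell2 and r s :: real
  show "x \<bullet> y = y \<bullet> x" by (simp add: inner_ell2_def inner_commute)
  show "(x + y) \<bullet> z = x \<bullet> z + y \<bullet> z"
    by (simp add: inner_ell2_def coord_simps inner_add_left suminf_add summable_coord_inner)
  show "(r *\<^sub>R x) \<bullet> y = r * (x \<bullet> y)"
    by (simp add: inner_ell2_def coord_simps suminf_mult summable_coord_inner)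
  show "0 \<le> x \<bullet> x" by (simp add: inner_ell2_def suminf_nonneg summable_coord_inner)
  show "x \<bullet> x = 0 \<longleftrightarrow> x = 0"
    using suminf_eq_zero_iff[OF summable_coord_inner[of x x]]
    by (auto simp: inner_ell2_def coord_zero intro!: ell2_eqI)
qed (rule ell2_eqI norm_ell2_def sgn_ell2_def dist_ell2_def uniformity_ell2_def open_ell2_def;
    simp add: coord_simps algebra_simps)+

end

lemma norm_coord_le: "norm (coord x n) \<le> norm x"
proof -
  have "(norm (coord x n))\<^sup>2 \<le> (norm x)\<^sup>2"
    using sum_le_suminf[OF summable_coord_inner[of x x], of "{n}"]
    by (simp add: power2_norm_eq_inner inner_ell2_def)
  then show ?thesis by (rule power2_le_imp_le) simp
qed

lemma sum_coord_le: "(\<Sum>i<k. (norm (coord x i))\<^sup>2) \<le> (norm x)\<^sup>2"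
  using sum_le_suminf[OF summable_coord_inner[of x x], of "{..<k}"]
  by (simp add: power2_norm_eq_inner inner_ell2_def)

instance ell2 :: banach
proof
  fix X :: "nat \<Rightarrow> ell2" assume X: "Cauchy X"
  have "Cauchy (\<lambda>m. coord (X m) n)" for n
  proof (rule metric_CauchyI)
    fix e :: real assume e: "e > 0"
    obtain N where N: "\<And>p q. p \<ge> N \<Longrightarrow> q \<ge> N \<Longrightarrow> dist (X p) (X q) < e"
      using metric_CauchyD[OF X e] by blast
    have "dist (coord (X p) n) (coord (X q) n) < e" if "p \<ge> N" "q \<ge> N" for p q
      using N[OF that] norm_coord_le[of "X p - X q" n] by (simp add: dist_norm coord_minus)
    then show "\<exists>M. \<forall>p\<ge>M. \<forall>q\<ge>M. dist (coord (X p) n) (coord (X q) n) < e" by blast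
  qed
  then obtain f where f: "\<And>n. (\<lambda>m. coord (X m) n) \<longlonglongrightarrow> f n"
    unfolding Cauchy_convergent_iff convergent_def by metis
  \<comment> \<open>The Cauchy bound on finite partial sums survives the coordinatewise limit,
    uniformly in the number of terms. It yields both square summability of \<open>f\<close> and
    convergence in norm.\<close>
  have tail: "\<exists>N. \<forall>p\<ge>N. \<forall>k. (\<Sum>i<k. (norm (f i - coord (X p) i))\<^sup>2) \<le> e\<^sup>2" if e: "e > 0" for e :: real
  proof -
    obtain N where N: "\<And>p q. p \<ge> N \<Longrightarrow> q \<ge> N \<Longrightarrow> dist (X p) (X q) < e"
      using metric_CauchyD[OF X e] by blast
    have "(\<Sum>i<k. (norm (f i - coord (X p) i))\<^sup>2) \<le> e\<^sup>2" if p: "p \<ge> N" for p k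
    proof (rule LIMSEQ_le_const2)
      show "(\<lambda>q. \<Sum>i<k. (norm (coord (X q) i - coord (X p) i))\<^sup>2) \<longlonglongrightarrow> (\<Sum>i<k. (norm (f i - coord (X p) i))\<^sup>2)"
        by (intro tendsto_intros f)
      have "(\<Sum>i<k. (norm (coord (X q) i - coord (X p) i))\<^sup>2) \<le> e\<^sup>2" if q: "q \<ge> N" for q
        using sum_coord_le[of "X q - X p" k] power_mono[of "norm (X q - X p)" e 2] N[OF q p]
        by (simp add: coord_minus dist_norm)
      then show "\<exists>N. \<forall>q\<ge>N. (\<Sum>i<k. (norm (coord (X q) i - coord (X p) i))\<^sup>2) \<le> e\<^sup>2" by blast
    qed
    then show ?thesis by blast
  qed
  have summ: "summable (\<lambda>i. (norm (f i - coord (X p) i))\<^sup>2)"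
    if "\<And>k. (\<Sum>i<k. (norm (f i - coord (X p) i))\<^sup>2) \<le> e\<^sup>2" for p e
    by (rule summableI_nonneg_bounded[where x = "e\<^sup>2"]) (use that in auto)
  obtain p where "\<And>k. (\<Sum>i<k. (norm (f i - coord (X p) i))\<^sup>2) \<le> 1\<^sup>2"
    using tail[of 1] by auto
  from summable_norm_add_square[OF summ[OF this] summable_coord[of "X p"]]
  have cf: "coord (Ell2 f) = f" by (intro coord_Ell2) simp
  have "X \<longlonglongrightarrow> Ell2 f"
  proof (rule metric_LIMSEQ_I)
    fix e :: real assume "e > 0"
    then obtain N where N: "\<And>p k. p \<ge> N \<Longrightarrow> (\<Sum>i<k. (norm (f i - coord (X p) i))\<^sup>2) \<le> (e / 2)\<^sup>2"
      using tail[of "e / 2"] by auto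
    have "dist (X p) (Ell2 f) < e" if p: "p \<ge> N" for p
    proof -
      have "(norm (Ell2 f - X p))\<^sup>2 = (\<Sum>i. (norm (f i - coord (X p) i))\<^sup>2)"
        by (simp add: power2_norm_eq_inner inner_ell2_def coord_minus cf)
      also have "\<dots> \<le> (e / 2)\<^sup>2"
        by (rule suminf_le_const[OF summ]) (rule N[OF p])+
      finally have "norm (Ell2 f - X p) \<le> e / 2"
        by (rule power2_le_imp_le) (use \<open>e > 0\<close> in simp)
      then show ?thesis using \<open>e > 0\<close> by (simp add: dist_norm norm_minus_commute)
    qed
    then show "\<exists>N. \<forall>p\<ge>N. dist (X p) (Ell2 f) < e" by blast
  qed
  then show "convergent X" by (rule convergentI)
qed

section \<open>Complex scalars and the Hermitian inner product on \<open>ell2\<close>\<close>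

definition cscale :: "complex \<Rightarrow> ell2 \<Rightarrow> ell2" where
  "cscale c x = Ell2 (\<lambda>n. c * coord x n)"

lemma coord_cscale: "coord (cscale c x) n = c * coord x n"
  unfolding cscale_def
  by (subst coord_Ell2) (simp_all add: norm_mult power_mult_distrib summable_mult summable_coord)

text \<open>For complex numbers the real inner product of \<open>a\<close> with
  \<open>\<i> * b\<close> is the imaginary part of \<open>a * cnj b\<close>, whence the second
  component.\<close>

definition cinner :: "ell2 \<Rightarrow> ell2 \<Rightarrow> complex" where
  "cinner x y = Complex (x \<bullet> y) (x \<bullet> cscale \<i> y)"

lemma cinner_sums: "(\<lambda>n. coord x n * cnj (coord y n)) sums cinner x y"
proof -
  have "(\<lambda>n. Complex (coord x n \<bullet> coord y n) (coord x n \<bullet> coord (cscale \<i> y) n)) sums cinner x y"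
    using summable_coord_inner by (simp add: sums_complex_iff cinner_def inner_ell2_def summable_sums)
  moreover have "Complex (coord x n \<bullet> coord y n) (coord x n \<bullet> coord (cscale \<i> y) n)
      = coord x n * cnj (coord y n)" for n
    by (simp add: complex_eq_iff inner_complex_def coord_cscale)
  ultimately show ?thesis by simp
qed

text \<open>Gram vectors are read off from a Cholesky factorization: each step splits off a rank-one
  kernel and passes to the Schur complement, which vanishes in the row just treated.\<close>

definition schur :: "(nat \<Rightarrow> nat \<Rightarrow> complex) \<Rightarrow> nat \<Rightarrow> nat \<Rightarrow> nat \<Rightarrow> complex" where
  "schur K n i j = K i j - K i n * K n j / K n n"

lemma pos_def_kernelD:
  fixes n :: nat
  assumes "pos_def_kernel K"
  shows "(\<Sum>i<n. \<Sum>j<n. K (x i) (x j) * \<xi> i * cnj (\<xi> j)) \<ge> 0"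
  using assms unfolding pos_def_kernel_def by blast

lemma pos_def_kernel_diag: "pos_def_kernel K \<Longrightarrow> K a a \<ge> 0"
  using pos_def_kernelD[of K "\<lambda>_. a" "\<lambda>_. 1" 1] by simp

lemma pos_def_kernel_two:
  assumes "pos_def_kernel K"
  shows "K a a * (s * cnj s) + K a b * s * cnj t + K b a * t * cnj s + K b b * (t * cnj t) \<ge> 0"
  using pos_def_kernelD[OF assms, where n = 2 and x = "\<lambda>i. if i = 0 then a else b"
      and \<xi> = "\<lambda>i. if i = 0 then s else t"]
  by (simp add: numeral_2_eq_2 algebra_simps)

text \<open>The diagonal terms of the form on two points are real. Its reality at coefficients 1, 1
  compares the imaginary parts of \<open>K a b\<close> and \<open>K b a\<close>; at 1,
  \<open>\<i>\<close> it compares the real parts.\<close>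

lemma pos_def_kernel_cnj:
  assumes "pos_def_kernel K"
  shows "K b a = cnj (K a b)"
proof -
  have "Im (K a a) = 0" "Im (K b b) = 0"
    using pos_def_kernel_diag[OF assms] by (auto simp: less_eq_complex_def)
  with pos_def_kernel_two[OF assms, of a 1 b 1] pos_def_kernel_two[OF assms, of a 1 b \<i>]
  show ?thesis by (simp add: less_eq_complex_def complex_eq_iff)
qed

text \<open>With a zero diagonal entry at \<open>b\<close> the form at coefficients 1 and
  \<open>- r * z\<close> is affine in \<open>r\<close>, and an affine function bounded below on the
  whole line has slope zero.\<close>

lemma pos_def_kernel_diag_zero:
  assumes K: "pos_def_kernel K" and "K b b = 0"
  shows "K a b = 0"
proof -
  define z where "z = K a b"
  have ba: "K b a = cnj z" by (simp add: z_def pos_def_kernel_cnj[OF K, of b a])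
  have bound: "0 \<le> Re (K a a) - 2 * r * (norm z)\<^sup>2" for r :: real
    using pos_def_kernel_two[OF K, of a 1 b "- of_real r * z"] assms(2) ba
    by (simp add: less_eq_complex_def cmod_def power2_eq_square z_def[symmetric] algebra_simps)
  have "(norm z)\<^sup>2 = 0"
  proof (rule ccontr)
    assume *: "(norm z)\<^sup>2 \<noteq> 0"
    \<comment> \<open>This \<open>r\<close> makes the right-hand side of \<open>bound\<close> equal
      to -1.\<close>
    from bound[of "(Re (K a a) + 1) / (2 * (norm z)\<^sup>2)"] * show False by simp
  qed
  then show ?thesis by (simp add: z_def)
qed

lemma pos_def_kernel_schur:
  assumes K: "pos_def_kernel K"
  shows "pos_def_kernel (schur K m)"
proof (cases "K m m = 0")
  case True
  \<comment> \<open>Division by zero gives zero, so a zero pivot leaves the kernel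
    unchanged.\<close>
  then have "schur K m = K" by (simp add: schur_def fun_eq_iff)
  then show ?thesis using K by simp
next
  case False
  show ?thesis
    unfolding pos_def_kernel_def
  proof (intro allI)
    fix n :: nat and x :: "nat \<Rightarrow> nat" and \<xi> :: "nat \<Rightarrow> complex"
    \<comment> \<open>The test family is extended by the point \<open>m\<close> with coefficient
      \<open>c = - s / K m m\<close>, which minimizes the form of \<open>K\<close> over that
      coefficient. The minimum is the form of the Schur complement.\<close>
    define s where "s = (\<Sum>i<n. K (x i) m * \<xi> i)"
    define y where "y i = (if i < n then x i else m)" for i
    define c where "c = - s / K m m"
    define \<eta> where "\<eta> i = (if i < n then \<xi> i else c)" for i
    have real: "cnj (K m m) = K m m" by (rule pos_def_kernel_cnj[OF K, symmetric])
    have s': "(\<Sum>j<n. K m (x j) * cnj (\<xi> j)) = cnj s"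
      unfolding s_def by (simp add: cnj_sum pos_def_kernel_cnj[OF K, of m])
    have "(\<Sum>i<Suc n. \<Sum>j<Suc n. K (y i) (y j) * \<eta> i * cnj (\<eta> j))
        = (\<Sum>i<n. \<Sum>j<n. K (x i) (x j) * \<xi> i * cnj (\<xi> j))
          + (\<Sum>i<n. K (x i) m * \<xi> i) * cnj c
          + c * (\<Sum>j<n. K m (x j) * cnj (\<xi> j)) + K m m * c * cnj c"
      by (simp add: y_def \<eta>_def sum.distrib sum_distrib_left sum_distrib_right mult_ac)
    also have "\<dots> = (\<Sum>i<n. \<Sum>j<n. K (x i) (x j) * \<xi> i * cnj (\<xi> j)) - s * cnj s / K m m"
      unfolding s' s_def[symmetric] c_def using False real by (simp add: field_simps)
    also have "s * cnj s / K m m = (\<Sum>i<n. \<Sum>j<n. K (x i) m * K m (x j) / K m m * \<xi> i * cnj (\<xi> j))"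
      unfolding s'[symmetric] unfolding s_def sum_product sum_divide_distrib by (simp add: mult_ac)
    finally show "(\<Sum>i<n. \<Sum>j<n. schur K m (x i) (x j) * \<xi> i * cnj (\<xi> j)) \<ge> 0"
      using pos_def_kernelD[OF K, of y \<eta> "Suc n"]
      by (simp add: schur_def left_diff_distrib sum_subtractf)
  qed
qed

primrec cholesky_rest :: "(nat \<Rightarrow> nat \<Rightarrow> complex) \<Rightarrow> nat \<Rightarrow> nat \<Rightarrow> nat \<Rightarrow> complex" where
  "cholesky_rest K 0 = K"
| "cholesky_rest K (Suc n) = schur (cholesky_rest K n) n"

text \<open>Column \<open>n\<close> of the factor. At a zero pivot the division makes it zero, in
  accordance with \<open>pos_def_kernel_diag_zero\<close>.\<close>

definition cholesky :: "(nat \<Rightarrow> nat \<Rightarrow> complex) \<Rightarrow> nat \<Rightarrow> nat \<Rightarrow> complex" where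
  "cholesky K i n = cholesky_rest K n i n / csqrt (cholesky_rest K n n n)"

context
  fixes K :: "nat \<Rightarrow> nat \<Rightarrow> complex"
  assumes K: "pos_def_kernel K"
begin

lemma pos_def_cholesky_rest: "pos_def_kernel (cholesky_rest K n)"
  by (induction n) (simp_all add: K pos_def_kernel_schur)

lemma cholesky_rest_zero: "i < n \<Longrightarrow> cholesky_rest K n i j = 0"
proof (induction n arbitrary: j)
  case (Suc n)
  let ?L = "cholesky_rest K n"
  show ?case
  proof (cases "i = n")
    case True
    have "?L n j = cnj (?L j n)" by (rule pos_def_kernel_cnj[OF pos_def_cholesky_rest])
    then show ?thesis
      using True pos_def_kernel_diag_zero[OF pos_def_cholesky_rest, of n n j]
      by (cases "?L n n = 0") (simp_all add: schur_def)
  next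
    case False
    with Suc show ?thesis by (simp add: schur_def)
  qed
qed simp

text \<open>The sum telescopes: its term at \<open>m\<close> is the rank-one kernel that the Schur
  step at \<open>m\<close> subtracts.\<close>

lemma cholesky_sum: "(\<Sum>m<n. cholesky K i m * cnj (cholesky K j m)) = K i j - cholesky_rest K n i j"
proof (induction n)
  case (Suc n)
  let ?L = "cholesky_rest K n"
  have "?L n n \<ge> 0" by (rule pos_def_kernel_diag[OF pos_def_cholesky_rest])
  then have "csqrt (?L n n) * cnj (csqrt (?L n n)) = ?L n n"
    by (cases "?L n n") (simp add: less_eq_complex_def complex_eq_iff)
  moreover have "cnj (?L j n) = ?L n j"
    by (rule pos_def_kernel_cnj[OF pos_def_cholesky_rest, symmetric])
  ultimately have "cholesky K i n * cnj (cholesky K j n) = ?L i n * ?L n j / ?L n n"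
    by (simp add: cholesky_def)
  with Suc show ?case by (simp add: schur_def)
qed simp

theorem gram_vectors: "\<exists>v. \<forall>i j. cinner (v i) (v j) = K i j"
proof (intro exI allI)
  have zero: "cholesky K i n = 0" if "n > i" for i n
    using cholesky_rest_zero[OF that] by (simp add: cholesky_def)
  have coord: "coord (Ell2 (cholesky K i)) = cholesky K i" for i
    by (rule coord_Ell2, rule summable_finite[of "{..i}"]) (auto simp: zero not_le)
  fix i j
  \<comment> \<open>Row \<open>i\<close> of the factor vanishes beyond column \<open>i\<close>, so
    the series stops there, and after \<open>Suc i\<close> steps row \<open>i\<close> of the
    remainder is zero.\<close>
  have "(\<lambda>n. cholesky K i n * cnj (cholesky K j n)) sums (\<Sum>n<Suc i. cholesky K i n * cnj (cholesky K j n))"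
    by (rule sums_finite) (auto simp: zero)
  moreover have "\<dots> = K i j"
    unfolding cholesky_sum using cholesky_rest_zero[of i "Suc i"] by simp
  ultimately show "cinner (Ell2 (cholesky K i)) (Ell2 (cholesky K j)) = K i j"
    using cinner_sums[of "Ell2 (cholesky K i)" "Ell2 (cholesky K j)"] by (simp add: coord sums_unique2)
qed

end

section \<open>The representation\<close>

lemma cscale_eq: "cscale c x = Re c *\<^sub>R x + Im c *\<^sub>R cscale \<i> x"
  by (rule ell2_eqI) (simp add: coord_simps coord_cscale complex_eq_iff)

lemma norm_cscale_i: "norm (cscale \<i> x) = norm x"
  by (simp add: norm_eq_sqrt_inner inner_ell2_def coord_cscale inner_complex_def add.commute)

interpretation ell2: complex_structure "cscale \<i>"
proof (rule complex_structure.intro)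
  show "bounded_linear (cscale \<i>)"
    by (rule bounded_linear_intro[of _ 1])
      (auto intro!: ell2_eqI simp: coord_simps coord_cscale algebra_simps norm_cscale_i)
  show "cscale \<i> (cscale \<i> x) = - x" for x
    by (rule ell2_eqI) (simp add: coord_simps coord_cscale mult.assoc[symmetric])
qed (rule norm_cscale_i)

lemma cscale_add: "cscale c (x + y) = cscale c x + cscale c y"
  and add_cscale: "cscale (c + d) x = cscale c x + cscale d x"
  and cscale_cscale: "cscale c (cscale d x) = cscale (c * d) x"
  and cscale_one: "cscale 1 x = x"
  and cscale_minus_one: "cscale (- 1) x = - x"
  by (rule ell2_eqI, simp add: coord_simps coord_cscale algebra_simps)+

lemma cinner_add_left: "cinner (x + y) z = cinner x z + cinner y z"
  using sums_add[OF cinner_sums[of x z] cinner_sums[of y z]] cinner_sums[of "x + y" z]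
  by (simp add: coord_simps distrib_right sums_unique2)

lemma cinner_scale_left: "cinner (cscale c x) y = c * cinner x y"
  using sums_mult[OF cinner_sums[of x y], of c] cinner_sums[of "cscale c x" y]
  by (simp add: coord_cscale mult.assoc sums_unique2)

lemma cinner_commute: "cinner y x = cnj (cinner x y)"
  using ell2.inner_J_left[of y x] by (simp add: cinner_def complex_eq_iff inner_commute)

lemma cinner_self: "cinner x x = of_real (x \<bullet> x)"
  using ell2.inner_J_left[of x x] by (simp add: cinner_def complex_eq_iff inner_commute)

text \<open>The index map \<^term>\<open>\<lambda>p. nat (fst p)\<close> only has to be onto, for injectivity.\<close>

definition to_fun :: "ell2 \<Rightarrow> int \<times> int \<Rightarrow> complex" where
  "to_fun x = (\<lambda>p. coord x (nat (fst p)))"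

definition of_fun :: "(int \<times> int \<Rightarrow> complex) \<Rightarrow> ell2" where
  "of_fun = inv to_fun"

lemma inj_to_fun: "inj to_fun"
proof (rule injI)
  fix x y assume *: "to_fun x = to_fun y"
  have "coord x n = coord y n" for n
    using fun_cong[OF *, of "(int n, 0)"] by (simp add: to_fun_def)
  then show "x = y" by (rule ell2_eqI)
qed

lemma of_fun_to_fun [simp]: "of_fun (to_fun x) = x"
  by (simp add: of_fun_def inj_to_fun)

lemma to_fun_eq_iff [simp]: "to_fun x = to_fun y \<longleftrightarrow> x = y"
  by (simp add: inj_to_fun inj_eq)

text \<open>Transports the structure of \<open>S\<close> along \<open>to_fun\<close> to the function
  type in which the Hilbert space is to be found. The operations matter only on the range of
  \<open>to_fun\<close>.\<close>

definition fun_hspace :: "ell2 set \<Rightarrow> (int \<times> int \<Rightarrow> complex) hspace" where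
  "fun_hspace S = \<lparr>hcarrier = to_fun ` S,
     hadd = (\<lambda>x y. to_fun (of_fun x + of_fun y)), hzero = to_fun 0,
     hscale = (\<lambda>c x. to_fun (cscale c (of_fun x))), hinner = (\<lambda>x y. cinner (of_fun x) (of_fun y))\<rparr>"

lemma fun_hspace_simps [simp]:
  "hcarrier (fun_hspace S) = to_fun ` S" "hzero (fun_hspace S) = to_fun 0"
  "hadd (fun_hspace S) (to_fun x) (to_fun y) = to_fun (x + y)"
  "hscale (fun_hspace S) c (to_fun x) = to_fun (cscale c x)"
  "hinner (fun_hspace S) (to_fun x) (to_fun y) = cinner x y"
  by (simp_all add: fun_hspace_def)

lemma hnorm_fun_hspace: "hnorm (fun_hspace S) (hsub (fun_hspace S) (to_fun x) (to_fun y)) = dist x y"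
  by (simp add: hnorm_def hsub_def cscale_minus_one cinner_self dist_norm norm_eq_sqrt_inner)

lemma closed_csubspace_cscale: "ell2.closed_csubspace S \<Longrightarrow> x \<in> S \<Longrightarrow> cscale c x \<in> S"
  unfolding cscale_eq[of c x]
  by (intro subspace_add subspace_scale ell2.closed_csubspaceD)

lemma complex_hilbert_space_fun_hspace:
  assumes S: "ell2.closed_csubspace S"
  shows "complex_hilbert_space (fun_hspace S)"
proof -
  note SD = ell2.closed_csubspaceD[OF S]
  have complete: "\<exists>l\<in>to_fun ` S. (\<lambda>n. hnorm (fun_hspace S) (hsub (fun_hspace S) (f n) l)) \<longlonglongrightarrow> 0"
    if f: "\<And>n. f n \<in> to_fun ` S"
      and C: "\<forall>e>0. \<exists>N. \<forall>m\<ge>N. \<forall>n\<ge>N. hnorm (fun_hspace S) (hsub (fun_hspace S) (f m) (f n)) < e" for f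
  proof -
    obtain x where x: "\<And>n. x n \<in> S" "\<And>n. f n = to_fun (x n)"
      using f unfolding image_iff by metis
    have "Cauchy x" using C unfolding Cauchy_def x(2) hnorm_fun_hspace .
    then obtain l where l: "x \<longlonglongrightarrow> l" unfolding Cauchy_convergent_iff convergent_def by blast
    have "l \<in> S" using closed_sequentially[OF SD(2) _ l] x(1) by blast
    moreover have "(\<lambda>n. hnorm (fun_hspace S) (hsub (fun_hspace S) (f n) (to_fun l))) \<longlonglongrightarrow> 0"
      unfolding x(2) hnorm_fun_hspace using l by (rule tendsto_dist_iff[THEN iffD1])
    ultimately show ?thesis by blast
  qed
  show ?thesis
    unfolding complex_hilbert_space_def Let_def
  \<comment> \<open>The cases treated separately are completeness (17), commutativity of addition
    (5) and Hermitian symmetry (14).\<close>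
  proof (intro conjI allI impI, goal_cases)
    case (17 f)
    then show ?case using complete by simp
  next
    case 5
    then show ?case by (simp add: add.commute)
  next
    case 14
    then show ?case by (simp flip: cinner_commute)
  qed (simp_all add: inj_image_mem_iff[OF inj_to_fun] subspace_0 subspace_add SD(1) closed_csubspace_cscale[OF S]
      cscale_add add_cscale cscale_cscale cscale_one cscale_minus_one add.assoc
      cinner_add_left cinner_scale_left cinner_self less_eq_complex_def)
qed

definition fun_op :: "(ell2 \<Rightarrow> ell2) \<Rightarrow> (int \<times> int \<Rightarrow> complex) \<Rightarrow> int \<times> int \<Rightarrow> complex" where
  "fun_op f x = to_fun (f (of_fun x))"

lemma fun_op_to_fun [simp]: "fun_op f (to_fun x) = to_fun (f x)"
  by (simp add: fun_op_def)

lemma unitary_op_fun_op: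
  assumes S: "ell2.closed_csubspace S" and f: "ell2.unitary_on S f"
  shows "unitary_op (fun_hspace S) (fun_op f)"
proof -
  note SD = ell2.closed_csubspaceD[OF S] and fD = ell2.unitary_onD[OF f]
  interpret f: bounded_linear f by (rule fD(1))
  have f_cscale: "f (cscale c x) = cscale c (f x)" if "x \<in> S" for c x
    unfolding cscale_eq[of c] by (simp add: f.add f.scaleR fD(4)[OF that])
  have inj: "x = y" if "x \<in> S" "y \<in> S" "f x = f y" for x y
    using fD(3)[of "x - y"] that subspace_diff[OF SD(1)] by (simp add: f.diff)
  have "fun_op f ` to_fun ` S = to_fun ` S"
    using fD(2,5) by (force simp: image_image)
  moreover have "inj_on (fun_op f) (to_fun ` S)" using inj by (auto simp: inj_on_def)
  moreover have "cinner (f x) (f y) = cinner x y" if "x \<in> S" "y \<in> S" for x y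
    using ell2.unitary_on_inner[OF S f] that fD(4) SD(3) by (simp add: cinner_def flip: fD(4))
  ultimately show ?thesis
    by (auto simp: unitary_op_def bij_betw_def f.add f_cscale)
qed

text \<open>The orbit is given in advance as a family over all integers, so injectivity of
  \<open>f\<close> alone makes the inverse step back by one.\<close>

lemma op_ipow_orbit:
  assumes f: "bij_betw f (hcarrier H) (hcarrier H)"
    and a: "\<And>n. a n \<in> hcarrier H" "\<And>n. f (a n) = a (n + 1)"
  shows "op_ipow H f j (a k) = a (k + j)"
proof -
  have fwd: "(f ^^ n) (a k) = a (k + int n)" for n
    by (induction n) (simp_all add: a algebra_simps)
  have "inv_into (hcarrier H) f (a n) = a (n - 1)" for n
    using inv_into_f_f[OF bij_betw_imp_inj_on[OF f] a(1), of "n - 1"] by (simp add: a(2))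
  then have "(inv_into (hcarrier H) f ^^ n) (a k) = a (k - int n)" for n
    by (induction n) (simp_all add: algebra_simps)
  with fwd show ?thesis by (simp add: op_ipow_def)
qed

lemma to_fun_span:
  assumes "x \<in> span (A \<union> cscale \<i> ` A)"
  shows "to_fun x \<in> hspan (fun_hspace S) (to_fun ` A)"
  using assms
proof (induction rule: span_induct_alt)
  case base
  show ?case unfolding hspan_def by (auto intro!: exI[of _ "[]"])
next
  case (step r x y)
  from step(2) obtain cs where cs: "set (map snd cs) \<subseteq> to_fun ` A"
    "to_fun y = foldr (\<lambda>(a, v) acc. hadd (fun_hspace S) (hscale (fun_hspace S) a v) acc) cs (hzero (fun_hspace S))"
    unfolding hspan_def by blast
  \<comment> \<open>A real multiple of a generator or of \<open>\<i>\<close> times a generator is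
    one complex multiple, with scalar \<open>r\<close> or \<open>r * \<i>\<close>.\<close>
  from step(1) obtain c b where b: "b \<in> A" "r *\<^sub>R x = cscale c b"
  proof (elim UnE imageE)
    assume "x \<in> A"
    then show thesis using cscale_eq[of "of_real r" x] by (intro that[of x "of_real r"]) simp_all
  next
    fix b assume "x = cscale \<i> b" "b \<in> A"
    then show thesis using cscale_eq[of "of_real r * \<i>" b] by (intro that[of b "of_real r * \<i>"]) simp_all
  qed
  show ?case
    unfolding hspan_def mem_Collect_eq
  proof (intro exI conjI)
    show "set (map snd ((c, to_fun b) # cs)) \<subseteq> to_fun ` A" using cs(1) b(1) by simp
    show "to_fun (r *\<^sub>R x + y) = foldr (\<lambda>(a, v) acc. hadd (fun_hspace S) (hscale (fun_hspace S) a v) acc)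
        ((c, to_fun b) # cs) (hzero (fun_hspace S))"
      unfolding foldr.simps o_apply prod.case cs(2)[symmetric] by (simp add: b(2))
  qed
qed

lemma dense_span_fun_hspace:
  "dense_span (fun_hspace (ell2.cspan_closure A)) (to_fun ` A)"
  unfolding dense_span_def
proof (intro ballI allI impI)
  fix x and e :: real assume "x \<in> hcarrier (fun_hspace (ell2.cspan_closure A))" "e > 0"
  then obtain u where u: "x = to_fun u" "u \<in> closure (span (A \<union> cscale \<i> ` A))"
    by (auto simp: ell2.cspan_closure_def)
  with \<open>e > 0\<close> obtain y where "y \<in> span (A \<union> cscale \<i> ` A)" "dist y u < e"
    unfolding closure_approachable by blast
  then show "\<exists>y\<in>hspan (fun_hspace (ell2.cspan_closure A)) (to_fun ` A).
      hnorm (fun_hspace (ell2.cspan_closure A)) (hsub (fun_hspace (ell2.cspan_closure A)) x y) < e"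
    by (intro bexI[OF _ to_fun_span]) (simp_all add: u(1) hnorm_fun_hspace dist_commute)
qed

theorem theorem2p1:
  fixes K :: "int \<times> int \<Rightarrow> int \<times> int \<Rightarrow> complex"
  assumes "pos_def_kernel K"
    and "\<And>j k j' k'. K (j, k) (j', k') = K (j + 1, k) (j' + 1, k')"
    and "\<And>j k j' k'. j \<le> 0 \<Longrightarrow> j' \<le> 0 \<Longrightarrow>
           K (j, k) (j', k') = K (j, 2 ^ nat (- j) + k) (j', 2 ^ nat (- j') + k')"
  shows "\<exists>(H :: (int \<times> int \<Rightarrow> complex) hspace) U T \<psi>.
           complex_hilbert_space H \<and> unitary_op H U \<and> unitary_op H T \<and>
           (\<forall>x\<in>hcarrier H. U (T (inv_into (hcarrier H) U x)) = T (T x)) \<and>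
           \<psi> \<in> hcarrier H \<and>
           (\<forall>j k j' k'. hinner H (op_ipow H U j (op_ipow H T k \<psi>))
                                (op_ipow H U j' (op_ipow H T k' \<psi>)) = K (j, k) (j', k')) \<and>
           dense_span H {op_ipow H U j (op_ipow H T k \<psi>) | j k. True}"
proof -
  \<comment> \<open>Pairs of integers are enumerated by \<open>nat\<close>, the index set of the
    Cholesky factorization.\<close>
  define K' where "K' m n = K (from_nat m) (from_nat n)" for m n :: nat
  have "pos_def_kernel K'"
    unfolding pos_def_kernel_def K'_def using pos_def_kernelD[OF assms(1), of "\<lambda>i. from_nat (x i)" for x] by blast
  then obtain v where v: "\<And>m n. cinner (v m) (v n) = K' m n" using gram_vectors by blast
  define e where "e j k = v (to_nat (j, k))" for j k :: int
  have gram: "cinner (e j k) (e j' k') = K (j, k) (j', k')" for j k j' k'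
    by (simp add: e_def v K'_def)
  have inner: "e j k \<bullet> e j' k' = Re (K (j, k) (j', k'))"
    "e j k \<bullet> cscale \<i> (e j' k') = Im (K (j, k) (j', k'))" for j k j' k'
    by (simp_all add: cinner_def flip: gram)
  define S where "S = ell2.cspan_closure (range (case_prod e))"
  have S: "ell2.closed_csubspace S" unfolding S_def by (rule ell2.closed_csubspace_cspan_closure)
  have eS: "e j k \<in> S" for j k
    unfolding S_def by (rule ell2.cspan_closure_base) (auto intro: rev_image_eqI[of "(j, k)"])
  obtain U T where U: "ell2.unitary_on S U" and T: "ell2.unitary_on S T"
    and Ue: "\<And>j k. U (e j k) = e (j + 1) k" and Te: "\<And>k. T (e 0 k) = e 0 (k + 1)"
    and UT: "\<And>x. x \<in> S \<Longrightarrow> U (T x) = T (T (U x))"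
  proof -
    have "\<exists>U T. ell2.unitary_on S U \<and> ell2.unitary_on S T \<and> (\<forall>j k. U (e j k) = e (j + 1) k) \<and>
        (\<forall>k. T (e 0 k) = e 0 (k + 1)) \<and> (\<forall>x\<in>S. U (T x) = T (T (U x)))"
      unfolding S_def
      by (rule ell2.baumslag_solitar_representation)
        (simp_all only: inner assms(2)[symmetric] assms(3)[symmetric])
    then show ?thesis using that by blast
  qed
  let ?H = "fun_hspace S" and ?U = "fun_op U" and ?T = "fun_op T"
  note UH = unitary_op_fun_op[OF S U] and TH = unitary_op_fun_op[OF S T]
  have bij: "bij_betw ?U (hcarrier ?H) (hcarrier ?H)" "bij_betw ?T (hcarrier ?H) (hcarrier ?H)"
    using UH TH by (auto simp: unitary_op_def)
  \<comment> \<open>\<open>T\<close> acts first and stays within level 0, where it is the shift of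
    \<open>k\<close>; the power of \<open>U\<close> then changes the level.\<close>
  have "op_ipow ?H ?T k (to_fun (e 0 0)) = to_fun (e 0 k)" for k
    using op_ipow_orbit[OF bij(2), of "\<lambda>n. to_fun (e 0 n)" k 0] by (simp add: eS Te)
  moreover have "op_ipow ?H ?U j (to_fun (e 0 k)) = to_fun (e j k)" for j k
    using op_ipow_orbit[OF bij(1), of "\<lambda>n. to_fun (e n k)" j 0] by (simp add: eS Ue)
  ultimately have orbit: "op_ipow ?H ?U j (op_ipow ?H ?T k (to_fun (e 0 0))) = to_fun (e j k)" for j k
    by simp
  have "?U (?T (inv_into (hcarrier ?H) ?U x)) = ?T (?T x)" if "x \<in> hcarrier ?H" for x
  proof -
    from that obtain z where z: "z \<in> S" "x = to_fun z" by auto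
    then obtain y where y: "y \<in> S" "x = ?U (to_fun y)"
      using ell2.unitary_onD(5)[OF U z(1)] by auto
    then have "inv_into (hcarrier ?H) ?U x = to_fun y"
      using bij_betw_inv_into_left[OF bij(1), of "to_fun y"] by simp
    then show ?thesis using y UT by simp
  qed
  moreover have "{op_ipow ?H ?U j (op_ipow ?H ?T k (to_fun (e 0 0))) | j k. True}
      = to_fun ` range (case_prod e)"
    unfolding orbit by auto
  then have "dense_span ?H {op_ipow ?H ?U j (op_ipow ?H ?T k (to_fun (e 0 0))) | j k. True}"
    unfolding S_def using dense_span_fun_hspace by simp
  ultimately show ?thesis
    using complex_hilbert_space_fun_hspace[OF S] UH TH eS
    by (intro exI[of _ ?H] exI[of _ ?U] exI[of _ ?T] exI[of _ "to_fun (e 0 0)"])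
      (simp add: orbit gram)
qed

end
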